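(* Let $Q$ be a finite symmetric quiver. In the ring $\mathbb{Q}(q^{\frac12})[[x_i: i\in Q_0]]$, the motivic generating series $A_Q(x,q)$ of $Q$ and the Poincaré series of the algebra $\mathcal A_Q$ are related by $$A_Q(x,q)=P(\mathcal A_Q,q^{\frac12}x,q),$$ where $q^{1/2}x$ means that each $x_i$ is replaced by $q^{1/2}x_i$ (each of the two series is viewed as an element of this ring, its coefficients being expansions of rational functions of $q^{1/2}$).
   Context: $Q$ is a finite quiver with vertex set $Q_0$; $m_{i,j}$ is the number of arrows from $i$ to $j$; symmetric means $m_{i,j}=m_{j,i}$. $L=\mathbb{Z}^{Q_0}$ with standard basis $\alpha_i$, $x^{\mathbf d}=\prod_i x_i^{\mathbf d_i}$, $\chi(\mathbf d,\mathbf e)=\sum_i\mathbf d_i\mathbf e_i-\sum_{i,j}m_{i,j}\mathbf d_i\mathbf e_j$, $(q)_n=(1-q)\cdots(1-q^n)$. Motivic generating series: $A_Q(x,q)=\sum_{\mathbf d\in\mathbb{Z}_{\ge0}^{Q_0}}\frac{(-q^{1/2})^{-\chi(\mathbf d,\mathbf d)}x^{\mathbf d}}{\prod_{i}(q^{-1})_{\mathbf d_i}}$. The algebra $\mathcal A_Q$ is the associative $\mathbb{Q}$-algebra with generators $a_{i,k}$ ($i\in Q_0$, $k\ge0$) of degree $(\alpha_i,-2k-m_{i,i})\in L\times\mathbb{Z}$ and relations $a_{i,k_1}a_{j,k_2}=(-1)^{m_{i,i}m_{j,j}}a_{j,k_2}a_{i,k_1}$ for all $i,j,k_1,k_2$,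 and $\sum_{k_1+k_2=k}\binom{k_2}{p}a_{i,k_1}a_{j,k_2}=0$ for all $i,j\in Q_0$, $k\ge0$, $0\le p<m_{i,j}$. Poincaré series of an $L\times\mathbb{Z}$-graded space: $P(V,x,q)=\sum_{\mathbf d}\sum_k\dim(V_{\mathbf d}^k)(-q^{1/2})^{-k}x^{\mathbf d}$. *)

theory Defs
  imports
    "Graph_Theory.Digraph"
    "HOL-Algebra.QuotRing"
    "HOL-Algebra.Embedded_Algebras"
    "HOL-Library.Poly_Mapping"
    "HOL-Computational_Algebra.Computational_Algebra"
begin

section \<open>Quivers\<close>

text \<open>A finite quiver is a \<^locale>\<open>fin_digraph\<close>: loops and parallel arcs are allowed.\<close>

definition num_arrows :: "('v, 'e) pre_digraph \<Rightarrow> 'v \<Rightarrow> 'v \<Rightarrow> nat" where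
  "num_arrows Q i j = card {e \<in> arcs Q. tail Q e = i \<and> head Q e = j}"

text \<open>This is stronger than \<^const>\<open>symmetric\<close>, which ignores multiplicities.\<close>

definition symmetric_quiver :: "('v, 'e) pre_digraph \<Rightarrow> bool" where
  "symmetric_quiver Q \<longleftrightarrow> (\<forall>i\<in>verts Q. \<forall>j\<in>verts Q. num_arrows Q i j = num_arrows Q j i)"

text \<open>
  The lattice \<open>L\<close> is represented by \<open>'v \<Rightarrow>\<^sub>0 int\<close>, with \<open>\<alpha>\<^sub>i = Poly_Mapping.single i 1\<close>.
\<close>

definition euler_form :: "('v, 'e) pre_digraph \<Rightarrow> ('v \<Rightarrow>\<^sub>0 int) \<Rightarrow> ('v \<Rightarrow>\<^sub>0 int) \<Rightarrow> int" where
  "euler_form Q d e =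
     (\<Sum>i\<in>verts Q. Poly_Mapping.lookup d i * Poly_Mapping.lookup e i)
     - (\<Sum>i\<in>verts Q. \<Sum>j\<in>verts Q. int (num_arrows Q i j)
          * Poly_Mapping.lookup d i * Poly_Mapping.lookup e j)"


section \<open>Power series over the field of rational functions in \<open>q\<^sup>1\<^sup>/\<^sup>2\<close>\<close>

text \<open>
  The field of rational functions in \<open>q\<^sup>1\<^sup>/\<^sup>2\<close> is \<open>rat poly fract\<close>, the polynomial
  variable being \<open>q\<^sup>1\<^sup>/\<^sup>2\<close>.  A power series in the variables \<open>x\<^sub>i\<close> is the function sending an
  exponent \<open>d :: 'v \<Rightarrow>\<^sub>0 nat\<close> to the coefficient of \<open>x\<^sup>d\<close>; if only the \<open>x\<^sub>i\<close> with \<open>i\<close> a vertex are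
  to occur, the coefficients at all other exponents are zero.
\<close>

type_synonym ratfun = "rat poly fract"
type_synonym 'v series = "('v \<Rightarrow>\<^sub>0 nat) \<Rightarrow> ratfun"

definition q_half :: ratfun where
  "q_half = Fract [:0, 1:] 1"

abbreviation q_var :: ratfun where
  "q_var \<equiv> q_half ^ 2"

definition q_pochhammer :: "'a::comm_ring_1 \<Rightarrow> nat \<Rightarrow> 'a" where
  "q_pochhammer q n = (\<Prod>r=1..n. 1 - q ^ r)"

abbreviation exponent_weight :: "('v \<Rightarrow>\<^sub>0 nat) \<Rightarrow> ('v \<Rightarrow>\<^sub>0 int)" where
  "exponent_weight d \<equiv> Poly_Mapping.map int d"

definition motivic_series :: "('v, 'e) pre_digraph \<Rightarrow> 'v series" where
  "motivic_series Q d =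
     (if Poly_Mapping.keys d \<subseteq> verts Q then
        (- q_half) powi (- euler_form Q (exponent_weight d) (exponent_weight d))
        / (\<Prod>i\<in>verts Q. q_pochhammer (inverse q_var) (Poly_Mapping.lookup d i))
      else 0)"

text \<open>The substitution replacing every variable \<open>x\<^sub>i\<close> by \<open>c x\<^sub>i\<close>.\<close>

definition rescale_variables :: "ratfun \<Rightarrow> 'v series \<Rightarrow> 'v series" where
  "rescale_variables c P d = c ^ (\<Sum>i\<in>Poly_Mapping.keys d. Poly_Mapping.lookup d i) * P d"

text \<open>The expansion of a rational function in \<open>q\<^sup>1\<^sup>/\<^sup>2\<close> as a Laurent series in \<open>q\<^sup>1\<^sup>/\<^sup>2\<close>.\<close>

definition laurent_expansion :: "ratfun \<Rightarrow> rat fls" where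
  "laurent_expansion r =
     (THE F. \<exists>a b. b \<noteq> 0 \<and> r = Fract a b
        \<and> F = fps_to_fls (fps_of_poly a) / fps_to_fls (fps_of_poly b))"

lemma laurent_expansion_Fract:
  assumes "b \<noteq> 0"
  shows "laurent_expansion (Fract a b)
    = fps_to_fls (fps_of_poly a) / fps_to_fls (fps_of_poly b)"
  unfolding laurent_expansion_def
proof (rule the_equality)
  fix F :: "rat fls"
  assume "\<exists>u v. v \<noteq> 0 \<and> Fract a b = Fract u v
    \<and> F = fps_to_fls (fps_of_poly u) / fps_to_fls (fps_of_poly v)"
  then obtain u v where v: "v \<noteq> 0" "Fract a b = Fract u v"
    and F: "F = fps_to_fls (fps_of_poly u) / fps_to_fls (fps_of_poly v)"
    by blast
  hence "u * b = a * v"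
    using assms by (simp add: eq_fract)
  hence "fps_to_fls (fps_of_poly u) * fps_to_fls (fps_of_poly b)
      = fps_to_fls (fps_of_poly a) * (fps_to_fls (fps_of_poly v) :: rat fls)"
    by (metis fps_of_poly_mult fls_times_fps_to_fls)
  thus "F = fps_to_fls (fps_of_poly a) / fps_to_fls (fps_of_poly b)"
    using assms v by (simp add: F frac_eq_eq)
qed (use assms in blast)

lemma laurent_expansion_inject: "laurent_expansion r = laurent_expansion s \<longleftrightarrow> r = s"
proof (cases r, cases s)
  fix a b c d :: "rat poly"
  assume r: "r = Fract a b" "b \<noteq> 0" and s: "s = Fract c d" "d \<noteq> 0"
  have "laurent_expansion r = laurent_expansion s \<longleftrightarrow>
      fps_to_fls (fps_of_poly (a * d)) = (fps_to_fls (fps_of_poly (c * b)) :: rat fls)"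
    using r s by (simp add: laurent_expansion_Fract frac_eq_eq fps_of_poly_mult fls_times_fps_to_fls)
  thus "laurent_expansion r = laurent_expansion s \<longleftrightarrow> r = s"
    using r s by (simp add: eq_fract fps_of_poly_eq_iff)
qed


section \<open>The free associative algebra\<close>

text \<open>
  The free algebra is the monoid algebra of the free monoid; \<^type>\<open>list\<close> is wrapped so that
  concatenation becomes the addition on exponents which the multiplication of
  \<^type>\<open>poly_mapping\<close> is based on.
\<close>

datatype 'a free_monoid = Word (letters: "'a list")

instantiation free_monoid :: (type) monoid_add
begin

definition zero_free_monoid :: "'a free_monoid" where
  "zero_free_monoid = Word []"

definition plus_free_monoid :: "'a free_monoid \<Rightarrow> 'a free_monoid \<Rightarrow> 'a free_monoid" where
  "plus_free_monoid v w = Word (letters v @ letters w)"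

instance
  by standard (simp_all add: zero_free_monoid_def plus_free_monoid_def)

end

type_synonym 'a noncomm_poly = "'a free_monoid \<Rightarrow>\<^sub>0 rat"

definition free_algebra :: "'a set \<Rightarrow> 'a noncomm_poly ring" where
  "free_algebra X =
     \<lparr>carrier = {f. \<forall>w\<in>Poly_Mapping.keys f. set (letters w) \<subseteq> X},
      monoid.mult = (*), one = 1, zero = 0, add = (+)\<rparr>"

definition generator :: "'a \<Rightarrow> 'a noncomm_poly" where
  "generator g = Poly_Mapping.single (Word [g]) 1"


section \<open>The algebra of a quiver\<close>

text \<open>The pair \<open>(i, k)\<close> stands for the generator \<open>a\<^sub>i\<^sub>,\<^sub>k\<close>.\<close>

abbreviation quiver_free_algebra :: "('v, 'e) pre_digraph \<Rightarrow> ('v \<times> nat) noncomm_poly ring" where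
  "quiver_free_algebra Q \<equiv> free_algebra (verts Q \<times> UNIV)"

definition commutation_relations :: "('v, 'e) pre_digraph \<Rightarrow> ('v \<times> nat) noncomm_poly set" where
  "commutation_relations Q =
     {generator (i, k\<^sub>1) * generator (j, k\<^sub>2)
        - (-1) ^ (num_arrows Q i i * num_arrows Q j j) * (generator (j, k\<^sub>2) * generator (i, k\<^sub>1))
      | i j k\<^sub>1 k\<^sub>2. i \<in> verts Q \<and> j \<in> verts Q}"

definition arrow_relations :: "('v, 'e) pre_digraph \<Rightarrow> ('v \<times> nat) noncomm_poly set" where
  "arrow_relations Q =
     {(\<Sum>(k\<^sub>1, k\<^sub>2) \<in> {(k\<^sub>1, k\<^sub>2). k\<^sub>1 + k\<^sub>2 = k}.
         of_nat (k\<^sub>2 choose p) * (generator (i, k\<^sub>1) * generator (j, k\<^sub>2)))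
      | i j k p. i \<in> verts Q \<and> j \<in> verts Q \<and> p < num_arrows Q i j}"

definition quiver_ideal :: "('v, 'e) pre_digraph \<Rightarrow> ('v \<times> nat) noncomm_poly set" where
  "quiver_ideal Q =
     Idl\<^bsub>quiver_free_algebra Q\<^esub> (commutation_relations Q \<union> arrow_relations Q)"

definition quiver_algebra :: "('v, 'e) pre_digraph \<Rightarrow> ('v \<times> nat) noncomm_poly set ring" where
  "quiver_algebra Q = quiver_free_algebra Q Quot quiver_ideal Q"

definition quiver_proj ::
    "('v, 'e) pre_digraph \<Rightarrow> ('v \<times> nat) noncomm_poly \<Rightarrow> ('v \<times> nat) noncomm_poly set" where
  "quiver_proj Q f = quiver_ideal Q +>\<^bsub>quiver_free_algebra Q\<^esub> f"

text \<open>The copy of the rational numbers in the algebra, over which dimensions are taken.\<close>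

definition quiver_scalars :: "('v, 'e) pre_digraph \<Rightarrow> ('v \<times> nat) noncomm_poly set set" where
  "quiver_scalars Q = range (\<lambda>c. quiver_proj Q (Poly_Mapping.single 0 c))"

definition word_weight :: "('v \<times> nat) free_monoid \<Rightarrow> ('v \<Rightarrow>\<^sub>0 int)" where
  "word_weight w = (\<Sum>(i, k)\<leftarrow>letters w. Poly_Mapping.single i 1)"

definition word_degree :: "('v, 'e) pre_digraph \<Rightarrow> ('v \<times> nat) free_monoid \<Rightarrow> int" where
  "word_degree Q w = (\<Sum>(i, k)\<leftarrow>letters w. - 2 * int k - int (num_arrows Q i i))"

definition quiver_component ::
    "('v, 'e) pre_digraph \<Rightarrow> ('v \<Rightarrow>\<^sub>0 int) \<Rightarrow> int \<Rightarrow> ('v \<times> nat) noncomm_poly set set" where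
  "quiver_component Q d k = quiver_proj Q `
     {f \<in> carrier (quiver_free_algebra Q). \<forall>w\<in>Poly_Mapping.keys f.
         word_weight w = d \<and> word_degree Q w = k}"


section \<open>Poincare series\<close>

text \<open>
  \<open>V d k\<close> are the components of an \<open>L \<times> \<int>\<close>-graded vector space over the subfield \<open>K\<close> of the
  ring \<open>A\<close>.  Its Poincare series makes sense as a power series \<open>P\<close> with rational function
  coefficients iff all components are finite-dimensional, only weights with nonnegative entries
  occur, and, for each \<open>d\<close>, the sum of \<open>dim (V d k) (-q\<^sup>1\<^sup>/\<^sup>2)\<^sup>-\<^sup>k\<close> over all \<open>k\<close> is a Laurent series
  in \<open>q\<^sup>1\<^sup>/\<^sup>2\<close> which is the expansion of a rational function, namely of \<open>P d\<close>.  As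
  \<^const>\<open>laurent_expansion\<close> is injective, \<open>P\<close> is then unique.
\<close>

definition is_poincare_series ::
    "('a, 'm) ring_scheme \<Rightarrow> 'a set \<Rightarrow> (('v \<Rightarrow>\<^sub>0 int) \<Rightarrow> int \<Rightarrow> 'a set) \<Rightarrow> 'v series \<Rightarrow> bool" where
  "is_poincare_series A K V P \<longleftrightarrow>
     (\<forall>d k. ring.finite_dimension A K (V d k)) \<and>
     (\<forall>d k. d \<notin> range exponent_weight \<longrightarrow> V d k = {\<zero>\<^bsub>A\<^esub>}) \<and>
     (\<forall>d k. fls_nth (laurent_expansion (P d)) (- k)
        = (-1) powi (- k) * of_nat (ring.dim A K (V (exponent_weight d) k)))"

end

theory Submission
  imports
    Defs
    "HOL-Combinatorics.Transposition"
begin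

text \<open>
  A linear functional \<open>\<phi>\<close> on the free algebra is encoded by polynomials \<open>F vs\<close>, one for each
  sequence \<open>vs\<close> of vertices: the coefficient of \<open>x\<^sup>e\<close> is the value of \<open>\<phi>\<close> on the word
  with letters \<open>(vs ! s, e s)\<close>.  The functional respects the commutation relations iff an adjacent
  transposition of \<open>vs\<close> and of the variables changes \<open>F\<close> by the sign
  \<open>(-1)\<^bsup>m i i * m j j\<^esup>\<close>, and it respects the arrow relations iff \<open>(x\<^sub>s - x\<^sub>s\<^sub>+\<^sub>1)\<^bsup>m i j\<^esup>\<close>
  divides \<open>F vs\<close>, where \<open>i\<close> and \<open>j\<close> are the vertices at the positions \<open>s\<close> and \<open>s + 1\<close>.  By symmetry \<open>F vs\<close> is then
  divisible by the product of all \<open>(x\<^sub>s - x\<^sub>t)\<^bsup>m (vs ! s) (vs ! t)\<^esup>\<close>, and the cofactor is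
  symmetric in variables belonging to the same vertex.  Comparing leading monomials, the words whose
  exponent is the leading exponent of the product plus the largest exponent in an orbit form a
  basis of each component.  Orbits are multisets of labelled vertices, and these are counted by
  \<open>1 / \<Prod>\<^sub>i (q)\<^bsub>d i\<^esub>\<close>.
\<close>

section \<open>Finitely supported functions\<close>

text \<open>Functionals replace the reduction of words by relations with a comparison of leading
  monomials. Independence of the normal words comes from a triangular matrix of values of explicit
  functionals; spanning comes by contradiction from a functional that vanishes on the ideal and on
  all normal words of a component.

  The arrow relations amount to divisibility because a functional takes on them the coefficients of
  the p-th divided derivative in x_{s+1}, restricted to the diagonal x_s = x_{s+1}. Vanishing of
  these for all p < m_ij is vanishing to order m_ij. The same power is imposed for the orders i, j
  and j, i because the quiver is symmetric.

  Twice the degree of the product of differences, plus the loops counted along the shape, is the sum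
  of all m_ij d_i d_j. This is the lowest power of q^{1/2} in weight d and the numerator of the
  series. The squares d_i^2 in the Euler form and the substitution of q^{1/2} x for x together turn
  the denominators (q^{-1})_n into (q)_n.\<close>

abbreviation lookup :: "('a \<Rightarrow>\<^sub>0 'b::zero) \<Rightarrow> 'a \<Rightarrow> 'b" where
  "lookup \<equiv> Poly_Mapping.lookup"

abbreviation keys :: "('a \<Rightarrow>\<^sub>0 'b::zero) \<Rightarrow> 'a set" where
  "keys \<equiv> Poly_Mapping.keys"

lemma sum_single_lookup: "(\<Sum>e\<in>keys f. Poly_Mapping.single e (lookup f e)) = f"
  by (rule poly_mapping_eqI) (simp add: lookup_sum lookup_single when_def in_keys_iff)

lemma poly_mapping_single_induct [case_names single add]:
  fixes f :: "'b \<Rightarrow>\<^sub>0 'a::comm_monoid_add"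
  assumes single: "\<And>e c. P (Poly_Mapping.single e c)"
    and add: "\<And>f g. P f \<Longrightarrow> P g \<Longrightarrow> P (f + g)"
  shows "P f"
proof -
  have sum_P: "P (\<Sum>e\<in>A. Poly_Mapping.single e (h e))" if "finite A" for A and h :: "'b \<Rightarrow> 'a"
    using that
  proof induction
    case empty
    show ?case using single[of undefined 0] by simp
  qed (simp add: single add)
  show ?thesis
    using sum_P[of "keys f" "lookup f"] by (simp add: sum_single_lookup)
qed

lemma const_eq_zero_iff [simp]: "Poly_Mapping.single e a = 0 \<longleftrightarrow> a = 0"
  by (metis lookup_single_eq lookup_zero single_zero)

text \<open>Transport along a map of exponents; for an additive map this is a ring homomorphism, such as
  a renaming or an identification of variables.\<close>

definition push :: "('b \<Rightarrow> 'c) \<Rightarrow> ('b \<Rightarrow>\<^sub>0 'a::comm_monoid_add) \<Rightarrow> ('c \<Rightarrow>\<^sub>0 'a)" where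
  "push h f = (\<Sum>e\<in>keys f. Poly_Mapping.single (h e) (lookup f e))"

lemma push_superset:
  assumes "finite A" "keys f \<subseteq> A"
  shows "push h f = (\<Sum>e\<in>A. Poly_Mapping.single (h e) (lookup f e))"
  unfolding push_def using assms
  by (intro sum.mono_neutral_left) (auto simp: in_keys_iff)

lemma push_single [simp]: "push h (Poly_Mapping.single e c) = Poly_Mapping.single (h e) c"
  by (subst push_superset[of "{e}"]) auto

lemma push_zero [simp]: "push h 0 = 0"
  by (simp add: push_def)

lemma push_add: "push h (f + g) = push h f + push h g"
proof -
  let ?A = "keys f \<union> keys g"
  have "push h (f + g) = (\<Sum>e\<in>?A. Poly_Mapping.single (h e) (lookup (f + g) e))"
    by (rule push_superset) (use Poly_Mapping.keys_add[of f g] in auto)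
  also have "\<dots> = push h f + push h g"
    by (simp add: push_superset[of ?A f] push_superset[of ?A g] lookup_add single_add
        sum.distrib)
  finally show ?thesis .
qed

lemma push_diff: "push h (f - g) = push h f - push h (g :: 'b \<Rightarrow>\<^sub>0 'a::ab_group_add)"
  by (metis add_diff_cancel_right' diff_add_cancel push_add)

lemma push_mult:
  fixes f g :: "'b::monoid_add \<Rightarrow>\<^sub>0 'a::semiring_0"
  assumes h: "\<And>a b. h (a + b) = h a + h b"
  shows "push h (f * g) = push h f * push h g"
proof (induction f rule: poly_mapping_single_induct)
  case (single e c)
  show ?case
    by (induction g rule: poly_mapping_single_induct)
      (simp_all add: mult_single push_add distrib_left h)
next
  case (add f f')
  then show ?case by (simp add: push_add distrib_right)
qed

lemma push_one:
  assumes "h 0 = 0"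
  shows "push h (1 :: 'b::zero \<Rightarrow>\<^sub>0 'a::{comm_monoid_add,zero_neq_one}) = (1 :: 'c::zero \<Rightarrow>\<^sub>0 'a)"
  using assms push_single[of h 0 "1::'a"] by simp

lemma push_prod:
  fixes F :: "'i \<Rightarrow> 'b::comm_monoid_add \<Rightarrow>\<^sub>0 'a::comm_semiring_1"
  assumes h: "\<And>a b. h (a + b) = h a + h b" and "h 0 = 0"
  shows "push h (prod F A) = (\<Prod>i\<in>A. push h (F i))"
  by (induction A rule: infinite_finite_induct) (simp_all add: push_one push_mult assms)

lemma push_power:
  fixes f :: "'b::comm_monoid_add \<Rightarrow>\<^sub>0 'a::comm_semiring_1"
  assumes h: "\<And>a b. h (a + b) = h a + h b" and "h 0 = 0"
  shows "push h (f ^ n) = push h f ^ n"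
  by (induction n) (simp_all add: push_one push_mult assms)

lemma lookup_push:
  "lookup (push h f) x = (\<Sum>e | e \<in> keys f \<and> h e = x. lookup f e)"
  by (simp add: push_def lookup_sum lookup_single when_def sum.If_cases Int_def)

lemma lookup_push_inj: "inj h \<Longrightarrow> lookup (push h f) (h e) = lookup f e"
  by (induction f rule: poly_mapping_single_induct)
    (auto simp: push_add lookup_add lookup_single when_def inj_eq)

lemma lookup_single_times:
  fixes f :: "'b::cancel_comm_monoid_add \<Rightarrow>\<^sub>0 'a::semiring_0"
  shows "lookup (Poly_Mapping.single a c * f) (a + e) = c * lookup f e"
  by (induction f rule: poly_mapping_single_induct)
    (auto simp: distrib_left lookup_add mult_single lookup_single when_def)

lemma lookup_mult_sum:
  fixes f g :: "'b::monoid_add \<Rightarrow>\<^sub>0 'a::semiring_0"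
  shows "lookup (f * g) x =
    (\<Sum>(a, b) | a \<in> keys f \<and> b \<in> keys g \<and> a + b = x. lookup f a * lookup g b)"
proof -
  have "f * g = (\<Sum>a\<in>keys f. \<Sum>b\<in>keys g. Poly_Mapping.single (a + b) (lookup f a * lookup g b))"
    by (subst sum_single_lookup[of f, symmetric], subst sum_single_lookup[of g, symmetric]) (simp add: sum_product mult_single)
  then have "lookup (f * g) x =
      (\<Sum>(a, b)\<in>keys f \<times> keys g. if a + b = x then lookup f a * lookup g b else 0)"
    by (auto simp: lookup_sum lookup_single when_def sum.cartesian_product intro!: sum.cong)
  also have "\<dots> = (\<Sum>(a, b) | a \<in> keys f \<and> b \<in> keys g \<and> a + b = x. lookup f a * lookup g b)"
    by (rule sum.mono_neutral_cong_right) (auto split: if_splits)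
  finally show ?thesis .
qed


section \<open>Polynomials in positional variables\<close>

type_synonym 'a mpoly = "(nat \<Rightarrow>\<^sub>0 nat) \<Rightarrow>\<^sub>0 'a"

definition var :: "nat \<Rightarrow> 'a::comm_ring_1 mpoly" where
  "var s = Poly_Mapping.single (Poly_Mapping.single s 1) 1"

lemma var_power: "var s ^ n = Poly_Mapping.single (Poly_Mapping.single s n) 1"
  by (induction n) (simp_all add: var_def mult_single flip: single_add)

lemma var_inject [simp]: "var s = (var t :: 'a::comm_ring_1 mpoly) \<longleftrightarrow> s = t"
proof
  assume "var s = (var t :: 'a mpoly)"
  then have "keys (var s :: 'a mpoly) = keys (var t :: 'a mpoly)"
    by simp
  then have "Poly_Mapping.single s (1::nat) = Poly_Mapping.single t 1"
    by (simp add: var_def)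
  then show "s = t"
    by (metis lookup_single_eq lookup_single_not_eq zero_neq_one)
qed simp

lemma lookup_var_times:
  "lookup (var s * f) e =
    (if lookup e s = 0 then 0 else lookup f (e - Poly_Mapping.single s 1))"
proof (cases "lookup e s = 0")
  case True
  have "lookup (var s * f) e = 0"
  proof (rule ccontr)
    assume "lookup (var s * f) e \<noteq> 0"
    then have "e \<in> keys (var s * f)"
      by (simp add: in_keys_iff)
    then obtain b where "e = Poly_Mapping.single s 1 + b"
      using keys_mult[of "var s" f] by (auto simp: var_def)
    with True show False
      by (simp add: lookup_add)
  qed
  with True show ?thesis by simp
next
  case False
  then have "e = Poly_Mapping.single s 1 + (e - Poly_Mapping.single s 1)"
    by (intro poly_mapping_eqI) (auto simp: lookup_add lookup_minus lookup_single when_def)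
  then show ?thesis
    using False lookup_single_times[of "Poly_Mapping.single s 1" 1 f "e - Poly_Mapping.single s 1"]
    by (simp add: var_def)
qed


subsection \<open>Divisibility by powers of a difference of variables\<close>

text \<open>\<open>push (merge s t)\<close> is the substitution of \<open>x\<^sub>s\<close> for \<open>x\<^sub>t\<close>.\<close>

definition merge :: "nat \<Rightarrow> nat \<Rightarrow> (nat \<Rightarrow>\<^sub>0 nat) \<Rightarrow> (nat \<Rightarrow>\<^sub>0 nat)" where
  "merge s t e = Poly_Mapping.update t 0 e + Poly_Mapping.single s (lookup e t)"

lemma lookup_merge:
  "lookup (merge s t e) x =
    (if x = t then 0 else lookup e x) + (if x = s then lookup e t else 0)"
  by (simp add: merge_def lookup_add update.rep_eq lookup_single when_def)

lemma merge_add: "merge s t (a + b) = merge s t a + merge s t b"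
  by (rule poly_mapping_eqI) (simp add: lookup_merge lookup_add)

lemma merge_zero [simp]: "merge s t 0 = 0"
  by (rule poly_mapping_eqI) (simp add: lookup_merge)

lemmas push_merge_hom =
  push_mult[OF merge_add] push_prod[OF merge_add merge_zero] push_power[OF merge_add merge_zero]

lemma push_merge_var: "push (merge s t) (var x) = var (if x = t then s else x)"
  unfolding var_def push_single
  by (rule arg_cong[of _ _ "\<lambda>e. Poly_Mapping.single e 1"], rule poly_mapping_eqI)
    (auto simp: lookup_merge lookup_single when_def)

text \<open>On a monomial the substitution replaces \<open>x_t^k\<close> by \<open>x_s^k\<close>,
  and the difference of these powers is a multiple of \<open>x_s - x_t\<close>. Both sides are
  additive in \<open>f\<close>.\<close>

lemma var_diff_dvd_minus_merge:
  fixes f :: "'a::comm_ring_1 mpoly"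
  assumes "s \<noteq> t"
  shows "var s - var t dvd f - push (merge s t) f"
proof (induction f rule: poly_mapping_single_induct)
  case (single e c)
  let ?k = "lookup e t" and ?e = "Poly_Mapping.update t 0 e"
  have "e = ?e + Poly_Mapping.single t ?k"
    by (rule poly_mapping_eqI) (auto simp: lookup_add update.rep_eq lookup_single when_def)
  then have "Poly_Mapping.single e c = Poly_Mapping.single ?e c * var t ^ ?k"
    by (simp add: var_power mult_single)
  moreover have "push (merge s t) (Poly_Mapping.single e c) = Poly_Mapping.single ?e c * var s ^ ?k"
    by (simp add: merge_def var_power mult_single)
  ultimately have "Poly_Mapping.single e c - push (merge s t) (Poly_Mapping.single e c)
      = Poly_Mapping.single ?e c * (var t ^ ?k - var s ^ ?k)"
    by (simp add: right_diff_distrib)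
  moreover have "var s - var t dvd var t ^ ?k - (var s ^ ?k :: 'a mpoly)"
  proof -
    have "var t - var s dvd var t ^ ?k - (var s ^ ?k :: 'a mpoly)"
      by (rule dvdI, rule power_diff_sumr2)
    then show ?thesis
      using minus_dvd_iff[of "var s - var t :: 'a mpoly"] by simp
  qed
  ultimately show ?case by simp
next
  case (add f g)
  then show ?case
    by (metis add_diff_add dvd_add push_add)
qed

text \<open>The factor theorem: the multiples of \<open>var s - var t\<close> form the kernel of a
  substitution homomorphism. Over a domain this makes the difference a prime element.\<close>

lemma var_diff_dvd_iff:
  fixes f :: "'a::comm_ring_1 mpoly"
  assumes "s \<noteq> t"
  shows "var s - var t dvd f \<longleftrightarrow> push (merge s t) f = 0"
proof
  assume "var s - var t dvd f"
  then show "push (merge s t) f = 0"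
    using assms by (auto simp: dvd_def push_merge_hom push_diff push_merge_var)
next
  assume "push (merge s t) f = 0"
  then show "var s - var t dvd f"
    using var_diff_dvd_minus_merge[OF assms, of f] by simp
qed

text \<open>The kernel of the substitution is a prime ideal, so a factor \<open>D\<close> that
  survives it absorbs no power of \<open>var s - var t\<close>. Each step of the induction cancels
  the powers already found and moves one more into the cofactor.\<close>

lemma var_diff_power_dvd_multD:
  fixes D :: "'a::idom mpoly"
  assumes "s \<noteq> t" and D: "push (merge s t) D \<noteq> 0"
    and "(var s - var t) ^ m dvd D * g"
  shows "(var s - var t) ^ m dvd g"
  using assms(3)
proof (induction m)
  case (Suc m)
  let ?p = "var s - var t :: 'a mpoly"
  have p0: "?p \<noteq> 0"
    using \<open>s \<noteq> t\<close> by simp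
  obtain g' where g': "g = ?p ^ m * g'"
    using Suc.IH power_le_dvd[OF Suc.prems] by (auto elim: dvdE)
  obtain h where "D * g = ?p ^ Suc m * h"
    using Suc.prems by blast
  then have "?p ^ m * (D * g') = ?p ^ m * (?p * h)"
    by (simp add: g' algebra_simps)
  then have "D * g' = ?p * h"
    using p0 by simp
  then have "?p dvd D * g'" by simp
  then have "?p dvd g'"
    using D \<open>s \<noteq> t\<close> by (simp add: var_diff_dvd_iff push_merge_hom)
  then show ?case
    by (simp add: g' mult.commute mult_dvd_mono)
qed simp

text \<open>The differences are collected one pair at a time. The product so far does not vanish on
  the diagonal of the new pair, so the new power has to divide the cofactor. The
  \<open>c s t\<close> are units with square 1 and do not affect divisibility.\<close>

lemma prod_var_diff_dvd:
  fixes f :: "'a::idom mpoly" and c :: "nat \<Rightarrow> nat \<Rightarrow> 'a mpoly"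
  assumes "finite S" and "\<And>s t. (s, t) \<in> S \<Longrightarrow> s < t"
    and "\<And>s t. (s, t) \<in> S \<Longrightarrow> c s t * c s t = 1"
    and "\<And>s t. (s, t) \<in> S \<Longrightarrow> (var s - var t) ^ m s t dvd f"
  shows "(\<Prod>(s, t)\<in>S. c s t * (var s - var t) ^ m s t) dvd f"
  using assms
proof (induction S)
  case (insert p S)
  obtain s t where p: "p = (s, t)" by force
  let ?D = "\<Prod>(a, b)\<in>S. c a b * (var a - var b) ^ m a b"
  have "?D dvd f"
    using insert.prems by (intro insert.IH) simp_all
  then obtain g where f: "f = ?D * g" ..
  have c: "push (merge s t) (c a b) \<noteq> 0" if "(a, b) \<in> S" for a b
  proof
    assume "push (merge s t) (c a b) = 0"
    then have "push (merge s t) (c a b * c a b) = 0"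
      by (simp add: push_merge_hom)
    then show False
      using insert.prems(2)[of a b] that by (simp add: push_one)
  qed
  have "push (merge s t) ?D \<noteq> 0"
  proof
    assume "push (merge s t) ?D = 0"
    then obtain a b where ab: "(a, b) \<in> S"
      and "push (merge s t) (c a b * (var a - var b) ^ m a b) = 0"
      using insert.hyps(1) by (auto simp: push_merge_hom)
    then have "push (merge s t) (var a - var b :: 'a mpoly) = 0"
      using c by (simp add: push_merge_hom split: if_splits)
    then have "(if a = t then s else a) = (if b = t then s else b)"
      by (simp only: push_diff push_merge_var right_minus_eq var_inject)
    \<comment> \<open>Replacing \<open>x_t\<close> by \<open>x_s\<close> identifies two distinct
      variables only if they are \<open>x_s\<close> and \<open>x_t\<close>; the inequalities exclude
      the reversed pair.\<close>
    moreover have "a < b" "s < t" "(a, b) \<noteq> (s, t)"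
      using insert ab p by auto
    ultimately show False by (auto split: if_splits)
  qed
  moreover have "(var s - var t) ^ m s t dvd ?D * g" "s \<noteq> t"
    using insert.prems(1,3)[of s t] p f by auto
  ultimately obtain h where g: "g = (var s - var t) ^ m s t * h"
    using var_diff_power_dvd_multD[of s t ?D "m s t" g] by (auto elim: dvdE)
  have c1: "c s t * c s t = 1"
    using insert.prems(2)[of s t] p by simp
  have "f = (c s t * (var s - var t) ^ m s t * ?D) * (c s t * h)"
    using arg_cong[OF c1, of "\<lambda>x. x * ?D * (var s - var t) ^ m s t * h"]
    unfolding f g by (simp only: ac_simps mult_1_left)
  then have "(c s t * (var s - var t) ^ m s t) * ?D dvd f"
    by (rule dvdI)
  then show ?case
    using insert.hyps p by simp
qed simp

text \<open>If \<open>x\<^sub>s\<close> and \<open>x\<^sub>t\<close> do not occur in \<open>x\<^sup>e\<close>, this is the coefficient of \<open>x\<^sup>e x\<^sub>s\<^sup>k\<^sup>-\<^sup>p\<close> in the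
  \<open>p\<close>-th divided derivative of \<open>f\<close> with respect to \<open>x\<^sub>t\<close>, restricted to \<open>x\<^sub>t = x\<^sub>s\<close>.\<close>

definition diag_coeff :: "nat \<Rightarrow> nat \<Rightarrow> nat \<Rightarrow> (nat \<Rightarrow>\<^sub>0 nat) \<Rightarrow> nat \<Rightarrow> 'a::comm_ring_1 mpoly \<Rightarrow> 'a" where
  "diag_coeff s t p e k f =
     (\<Sum>l\<le>k. of_nat (l choose p)
        * lookup f (e + Poly_Mapping.single s (k - l) + Poly_Mapping.single t l))"

lemma diag_coeff_diff:
  "diag_coeff s t p e k (f - g) = diag_coeff s t p e k f - diag_coeff s t p e k g"
  by (simp add: diag_coeff_def lookup_minus right_diff_distrib sum_subtractf)

text \<open>The Leibniz rule along the diagonal: of the derivatives of \<open>(x_s - x_t) g\<close>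
  only the term survives in which the linear factor is differentiated once. On coefficients this is
  Pascal's rule. The index \<open>k\<close> is the joint degree in \<open>x_s\<close> and
  \<open>x_t\<close>, so it drops by one.\<close>

lemma diag_coeff_step:
  assumes "s \<noteq> t" "lookup e s = 0" "lookup e t = 0"
  shows "diag_coeff s t 0 e k ((var s - var t) * g) = 0"
    and "diag_coeff s t (Suc p) e (Suc k) ((var s - var t) * g) = - diag_coeff s t p e k g"
    and "diag_coeff s t p e 0 ((var s - var t) * g) = 0"
proof -
  let ?x = "\<lambda>k l. e + Poly_Mapping.single s (k - l) + Poly_Mapping.single t l"
  have shift_s: "?x (Suc k) l - Poly_Mapping.single s 1 = ?x k l" if "l \<le> k" for l k
    using assms that
    by (intro poly_mapping_eqI) (auto simp: lookup_add lookup_minus lookup_single when_def)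
  have shift_t: "?x (Suc k) (Suc l) - Poly_Mapping.single t 1 = ?x k l" for l k
    using assms
    by (intro poly_mapping_eqI) (auto simp: lookup_add lookup_minus lookup_single when_def)
  have at_s: "lookup (?x k l) s = k - l" and at_t: "lookup (?x k l) t = l" for k l
    using assms by (auto simp: lookup_add lookup_single when_def)
  \<comment> \<open>Multiplication by \<open>x_s\<close> loses the last summand and multiplication
    by \<open>x_t\<close> the first; the shift of \<open>l\<close> in the second case turns
    \<open>l choose p\<close> into \<open>Suc l choose p\<close>.\<close>
  have "lookup (var s * g) (?x (Suc k) l) = lookup g (?x k l)" if "l \<le> k" for k l
    unfolding lookup_var_times at_s shift_s[OF that] using that by simp
  moreover have "lookup (var s * g) (?x k k) = 0" for k
    unfolding lookup_var_times at_s by simp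
  ultimately have s: "diag_coeff s t p e (Suc k) (var s * g) = diag_coeff s t p e k g" for p k
    unfolding diag_coeff_def sum.atMost_Suc by (simp only: mult_zero_right add_0_right)
      (rule sum.cong, simp_all)
  have "lookup (var t * g) (?x (Suc k) (Suc l)) = lookup g (?x k l)" for k l
    unfolding lookup_var_times at_t shift_t by simp
  moreover have "lookup (var t * g) (?x k 0) = 0" for k
    unfolding lookup_var_times at_t by simp
  ultimately have t: "diag_coeff s t p e (Suc k) (var t * g)
      = (\<Sum>l\<le>k. of_nat (Suc l choose p) * lookup g (?x k l))" for p k
    unfolding diag_coeff_def sum.atMost_Suc_shift by (simp only: mult_zero_right add_0_left)
  have zero: "diag_coeff s t p e 0 (var s * g) = 0" "diag_coeff s t p e 0 (var t * g) = 0" for p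
    unfolding diag_coeff_def using at_s[of 0 0] at_t[of 0 0] by (simp_all add: lookup_var_times)
  show "diag_coeff s t p e 0 ((var s - var t) * g) = 0"
    by (simp add: left_diff_distrib diag_coeff_diff zero)
  show "diag_coeff s t (Suc p) e (Suc k) ((var s - var t) * g) = - diag_coeff s t p e k g"
    by (simp add: left_diff_distrib diag_coeff_diff s t)
      (simp add: diag_coeff_def distrib_right sum.distrib)
  show "diag_coeff s t 0 e k ((var s - var t) * g) = 0"
  proof (cases k)
    case (Suc k)
    then show ?thesis
      by (simp add: left_diff_distrib diag_coeff_diff s t) (simp add: diag_coeff_def)
  qed (simp add: left_diff_distrib diag_coeff_diff zero)
qed

text \<open>A coefficient after the substitution is a sum over a fibre of \<open>merge s t\<close>.
  For an exponent without \<open>x_t\<close> the fibre consists of all ways to split the exponent of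
  \<open>x_s\<close> between the two variables, and the sum is a \<open>diag_coeff\<close> with
  \<open>p = 0\<close>; for other exponents the fibre is empty.\<close>

lemma push_merge_eq_zeroI:
  fixes f :: "'a::comm_ring_1 mpoly"
  assumes "s \<noteq> t"
    and diag: "\<And>e k. lookup e s = 0 \<Longrightarrow> lookup e t = 0 \<Longrightarrow> diag_coeff s t 0 e k f = 0"
  shows "push (merge s t) f = 0"
proof (rule poly_mapping_eqI)
  fix x
  show "lookup (push (merge s t) f) x = lookup 0 x"
  proof (cases "lookup x t = 0")
    case False
    then have "merge s t e \<noteq> x" for e
      using lookup_merge[of s t e t] \<open>s \<noteq> t\<close> by auto
    then show ?thesis by (simp add: lookup_push)
  next
    case True
    define e where "e = Poly_Mapping.update s 0 x"
    define k where "k = lookup x s"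
    let ?x = "\<lambda>l. e + Poly_Mapping.single s (k - l) + Poly_Mapping.single t l"
    have at_t: "lookup (?x l) t = l" for l
      using True \<open>s \<noteq> t\<close> by (simp add: e_def lookup_add update.rep_eq lookup_single when_def)
    have "merge s t (?x l) = x" if "l \<le> k" for l
      using True \<open>s \<noteq> t\<close> that
      by (intro poly_mapping_eqI)
        (auto simp: lookup_merge e_def k_def lookup_add update.rep_eq lookup_single when_def)
    moreover have "y \<in> ?x ` {..k}" if "merge s t y = x" for y
    proof
      have "lookup x z = (if z = t then 0 else lookup y z) + (if z = s then lookup y t else 0)" for z
        using that lookup_merge[of s t y z] by simp
      then show "y = ?x (lookup y t)" "lookup y t \<in> {..k}"
        using \<open>s \<noteq> t\<close>
        by (auto intro!: poly_mapping_eqI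
            simp: e_def k_def lookup_add update.rep_eq lookup_single when_def)
    qed
    ultimately have fibre: "merge s t y = x \<longleftrightarrow> y \<in> ?x ` {..k}" for y
      by blast
    have "lookup (push (merge s t) f) x = (\<Sum>y\<in>?x ` {..k}. lookup f y)"
      unfolding lookup_push
      by (rule sum.mono_neutral_left)
        (simp_all only: fibre finite_imageI finite_atMost in_keys_iff, blast+)
    also have "\<dots> = diag_coeff s t 0 e k f"
      unfolding diag_coeff_def
      by (subst sum.reindex) (auto intro: inj_on_inverseI[of _ "\<lambda>y. lookup y t"] simp: at_t)
    also have "\<dots> = 0"
      using True \<open>s \<noteq> t\<close> by (intro diag) (auto simp: e_def update.rep_eq)
    finally show ?thesis by simp
  qed
qed

text \<open>The condition for \<open>p = 0\<close> splits off one factor, and the conditions for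
  \<open>Suc p\<close> on \<open>f\<close> are those for \<open>p\<close> on the quotient. In this
  form the binomial coefficients of the arrow relations become a divisibility.\<close>

lemma var_diff_power_dvd_iff:
  fixes f :: "'a::comm_ring_1 mpoly"
  assumes "s \<noteq> t"
  shows "(var s - var t) ^ m dvd f \<longleftrightarrow>
    (\<forall>p<m. \<forall>(e :: nat \<Rightarrow>\<^sub>0 nat) k.
      lookup e s = 0 \<longrightarrow> lookup e t = 0 \<longrightarrow> diag_coeff s t p e k f = 0)"
proof (induction m arbitrary: f)
  case (Suc m)
  let ?p = "var s - var t :: 'a mpoly"
  show ?case
  proof
    assume "?p ^ Suc m dvd f"
    then obtain h where "f = ?p * (?p ^ m * h)"
      by (auto simp: dvd_def mult.assoc)
    moreover have "?p ^ m dvd ?p ^ m * h" by simp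
    ultimately obtain g where f: "f = ?p * g" and g: "?p ^ m dvd g" by blast
    show "\<forall>p<Suc m. \<forall>(e :: nat \<Rightarrow>\<^sub>0 nat) k. lookup e s = 0 \<longrightarrow> lookup e t = 0 \<longrightarrow> diag_coeff s t p e k f = 0"
    proof (intro allI impI)
      fix p k and e :: "nat \<Rightarrow>\<^sub>0 nat" assume "p < Suc m" and e: "lookup e s = 0" "lookup e t = 0"
      then show "diag_coeff s t p e k f = 0"
        using g \<open>s \<noteq> t\<close> unfolding Suc.IH f
        by (cases p; cases k) (auto simp: diag_coeff_step)
    qed
  next
    assume diag: "\<forall>p<Suc m. \<forall>(e :: nat \<Rightarrow>\<^sub>0 nat) k.
        lookup e s = 0 \<longrightarrow> lookup e t = 0 \<longrightarrow> diag_coeff s t p e k f = 0"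
    then have "?p dvd f"
      using \<open>s \<noteq> t\<close> by (simp add: var_diff_dvd_iff push_merge_eq_zeroI)
    then obtain g where f: "f = ?p * g" ..
    have "diag_coeff s t p e k g = 0" if "p < m" "lookup e s = 0" "lookup e t = 0" for p k and e :: "nat \<Rightarrow>\<^sub>0 nat"
      using that diag diag_coeff_step(2)[OF \<open>s \<noteq> t\<close> that(2,3), of p k g]
      by (metis Suc_less_eq f neg_equal_0_iff_equal)
    then have "?p ^ m dvd g" by (simp add: Suc.IH)
    then show "?p ^ Suc m dvd f" unfolding f power_Suc by (rule mult_dvd_mono[OF dvd_refl])
  qed
qed simp


subsection \<open>Leading monomials\<close>

text \<open>The order on exponents is the lexicographic one with \<open>x\<^sub>0 > x\<^sub>1 > \<dots>\<close>.\<close>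

definition lead_monom :: "'a::zero mpoly \<Rightarrow> (nat \<Rightarrow>\<^sub>0 nat)" where
  "lead_monom f = Max (keys f)"

lemma lead_monom_in_keys: "f \<noteq> 0 \<Longrightarrow> lead_monom f \<in> keys f"
  unfolding lead_monom_def by (rule Max_in) (auto intro: poly_mapping_eqI simp: in_keys_iff)

lemma le_lead_monom: "e \<in> keys f \<Longrightarrow> e \<le> lead_monom f"
  by (simp add: lead_monom_def)

lemma lead_monom_eqI: "e \<in> keys f \<Longrightarrow> (\<And>x. x \<in> keys f \<Longrightarrow> x \<le> e) \<Longrightarrow> lead_monom f = e"
  unfolding lead_monom_def by (intro Max_eqI) auto

text \<open>The order is compatible with addition, so the sum of the leading exponents arises from
  no other pair, and its coefficient is a product of nonzero elements of a domain.\<close>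

lemma lead_monom_mult:
  fixes f g :: "'a::idom mpoly"
  assumes "f \<noteq> 0" "g \<noteq> 0"
  shows "lead_monom (f * g) = lead_monom f + lead_monom g"
proof (rule lead_monom_eqI)
  have "{(a, b). a \<in> keys f \<and> b \<in> keys g \<and> a + b = lead_monom f + lead_monom g}
      = {(lead_monom f, lead_monom g)}"
  proof -
    have "a = lead_monom f \<and> b = lead_monom g"
      if "a \<in> keys f" "b \<in> keys g" "a + b = lead_monom f + lead_monom g" for a b
    proof -
      have "a \<le> lead_monom f" "b \<le> lead_monom g"
        using that by (auto intro: le_lead_monom)
      moreover have "\<not> a < lead_monom f"
        using add_less_le_mono[of a "lead_monom f" b "lead_monom g"] \<open>b \<le> lead_monom g\<close> that(3)
        by auto
      ultimately have "a = lead_monom f"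
        by (metis order_le_imp_less_or_eq)
      with that(3) show ?thesis by simp
    qed
    then show ?thesis using assms by (auto intro: lead_monom_in_keys)
  qed
  then have "lookup (f * g) (lead_monom f + lead_monom g)
      = lookup f (lead_monom f) * lookup g (lead_monom g)"
    by (simp add: lookup_mult_sum)
  then show "lead_monom f + lead_monom g \<in> keys (f * g)"
    using assms lead_monom_in_keys[of f] lead_monom_in_keys[of g] by (simp add: in_keys_iff)
next
  fix x assume "x \<in> keys (f * g)"
  then show "x \<le> lead_monom f + lead_monom g"
    using keys_mult[of f g] by (auto intro!: add_mono le_lead_monom)
qed

lemma lead_monom_single [simp]: "c \<noteq> 0 \<Longrightarrow> lead_monom (Poly_Mapping.single e c) = e"
  by (rule lead_monom_eqI) auto

lemma lead_monom_one [simp]: "lead_monom (1 :: 'a::zero_neq_one mpoly) = 0"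
  by (rule lead_monom_eqI) auto

lemma lead_monom_prod:
  fixes F :: "'i \<Rightarrow> 'a::idom mpoly"
  assumes "\<And>i. i \<in> A \<Longrightarrow> F i \<noteq> 0"
  shows "lead_monom (prod F A) = (\<Sum>i\<in>A. lead_monom (F i))"
  using assms by (induction A rule: infinite_finite_induct) (simp_all add: lead_monom_mult)

lemma lead_monom_power:
  fixes f :: "'a::idom mpoly"
  assumes "f \<noteq> 0"
  shows "lead_monom (f ^ n) = (\<Sum>i<n. lead_monom f)"
  using lead_monom_prod[of "{..<n}" "\<lambda>_. f"] assms by simp

lemma lead_monom_var_diff:
  assumes "s < t"
  shows "lead_monom (var s - var t :: 'a::comm_ring_1 mpoly) = Poly_Mapping.single s 1"
proof (rule lead_monom_eqI)
  let ?f = "var s - var t :: 'a mpoly" and ?e = "\<lambda>s. Poly_Mapping.single s (1::nat)"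
  have le: "?e t \<le> ?e s"
    using assms by (auto simp: less_eq_poly_mapping.rep_eq less_fun_def lookup_single when_def)
  have neq: "?e t \<noteq> ?e s"
    using assms by (metis lookup_single_eq lookup_single_not_eq nat_neq_iff zero_neq_one)
  then show "?e s \<in> keys ?f"
    by (simp add: in_keys_iff lookup_minus var_def lookup_single when_def)
  fix x assume "x \<in> keys ?f"
  then have "x = ?e s \<or> x = ?e t"
    by (auto simp: in_keys_iff lookup_minus var_def lookup_single when_def split: if_splits)
  with le show "x \<le> ?e s" by auto
qed


subsection \<open>Adjacent transpositions\<close>

text \<open>Adjacent transpositions generate all permutations. The letters of \<open>ys\<close> are
  moved forward one after another, and the prefix \<open>u\<close> collects those already in
  place.\<close>

lemma mset_adjacent_induct [consumes 2, case_names swap]: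
  assumes "mset xs = mset ys" and "P xs"
    and swap: "\<And>u x y v. P (u @ x # y # v) \<Longrightarrow> P (u @ y # x # v)"
  shows "P ys"
proof -
  have move: "P (u @ x # v @ w)" if "P (u @ v @ x # w)" for u v w x
    using that
  proof (induction v arbitrary: w rule: rev_induct)
    case (snoc y v)
    from snoc.prems have "P ((u @ v) @ y # x # w)" by simp
    from swap[OF this] have "P (u @ v @ x # (y # w))" by simp
    from snoc.IH[OF this] show ?case by simp
  qed simp
  have "P (u @ xs) \<Longrightarrow> mset xs = mset ys \<Longrightarrow> P (u @ ys)" for u
  proof (induction ys arbitrary: xs u)
    case (Cons y ys)
    then have "y \<in> set xs"
      by (metis list.set_intros(1) mset_eq_setD)
    then obtain a b where xs: "xs = a @ y # b"
      by (meson split_list)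
    have "P ((u @ [y]) @ (a @ b))"
      using move[of u a y b] Cons.prems(1) by (simp add: xs)
    moreover have "mset (a @ b) = mset ys"
      using Cons.prems(2) by (simp add: xs)
    ultimately show ?case
      using Cons.IH by fastforce
  qed simp
  from this[of "[]"] show ?thesis
    using assms by simp
qed

definition swap_exp :: "nat \<Rightarrow> (nat \<Rightarrow>\<^sub>0 nat) \<Rightarrow> (nat \<Rightarrow>\<^sub>0 nat)" where
  "swap_exp s e = push (Transposition.transpose s (Suc s)) e"

lemma lookup_swap_exp: "lookup (swap_exp s e) x = lookup e (Transposition.transpose s (Suc s) x)"
proof -
  have "lookup (push (Transposition.transpose s (Suc s)) e)
      (Transposition.transpose s (Suc s) (Transposition.transpose s (Suc s) x))
      = lookup e (Transposition.transpose s (Suc s) x)"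
    by (rule lookup_push_inj) (rule inj_transpose)
  then show ?thesis
    by (simp add: swap_exp_def)
qed

lemma swap_exp_swap_exp [simp]: "swap_exp s (swap_exp s e) = e"
  by (rule poly_mapping_eqI) (simp add: lookup_swap_exp)

lemma swap_exp_add: "swap_exp s (a + b) = swap_exp s a + swap_exp s b"
  by (simp add: swap_exp_def push_add)

lemma swap_exp_zero [simp]: "swap_exp s 0 = 0"
  by (simp add: swap_exp_def)

lemma keys_swap_exp:
  assumes "keys e \<subseteq> {..<n}" "Suc s < n"
  shows "keys (swap_exp s e) \<subseteq> {..<n}"
proof
  fix x assume "x \<in> keys (swap_exp s e)"
  then have "Transposition.transpose s (Suc s) x \<in> keys e"
    by (simp add: in_keys_iff lookup_swap_exp)
  then have "Transposition.transpose s (Suc s) x < n"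
    using assms by auto
  with \<open>Suc s < n\<close> show "x \<in> {..<n}"
    by (cases "x = s \<or> x = Suc s") auto
qed

definition swap_poly :: "nat \<Rightarrow> 'a::comm_ring_1 mpoly \<Rightarrow> 'a mpoly" where
  "swap_poly s = push (swap_exp s)"

lemma swap_poly_mult: "swap_poly s (f * g) = swap_poly s f * swap_poly s g"
  and swap_poly_prod: "swap_poly s (prod F A) = (\<Prod>i\<in>A. swap_poly s (F i))"
  and swap_poly_power: "swap_poly s (f ^ n) = swap_poly s f ^ n"
  and swap_poly_diff: "swap_poly s (f - g) = swap_poly s f - swap_poly s g"
  and swap_poly_const: "swap_poly s (Poly_Mapping.single 0 c) = Poly_Mapping.single 0 c"
  unfolding swap_poly_def
  by (simp_all add: push_mult push_prod push_power push_diff swap_exp_add)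

lemma swap_poly_var: "swap_poly s (var x) = var (Transposition.transpose s (Suc s) x)"
  by (simp add: swap_poly_def var_def swap_exp_def)

lemma lookup_swap_poly: "lookup (swap_poly s f) e = lookup f (swap_exp s e)"
proof -
  have "inj (swap_exp s)"
    by (metis injI swap_exp_swap_exp)
  then have "lookup (push (swap_exp s) f) (swap_exp s (swap_exp s e)) = lookup f (swap_exp s e)"
    by (rule lookup_push_inj)
  then show ?thesis by (simp add: swap_poly_def)
qed

lemma swap_poly_swap_poly [simp]: "swap_poly s (swap_poly s f) = f"
  by (rule poly_mapping_eqI) (simp add: lookup_swap_poly)

lemma swap_poly_dvd: "f dvd g \<Longrightarrow> swap_poly s f dvd swap_poly s g"
  by (metis dvd_def swap_poly_mult)

lemma lookup_minus_one_power_times: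
  "lookup ((-1) ^ k * f) e = (-1) ^ k * lookup (f :: 'a::comm_ring_1 mpoly) e"
  by (cases "even k") simp_all


subsection \<open>Words as pairs of a shape and an exponent\<close>

definition word_exp :: "('v \<times> nat) list \<Rightarrow> (nat \<Rightarrow>\<^sub>0 nat)" where
  "word_exp w = Poly_Mapping.nth (map snd w)"

text \<open>Inverse to the passage from \<open>w\<close> to \<open>map fst w\<close> and
  \<open>word_exp w\<close>, provided that \<open>e\<close> is supported on the positions of
  \<open>vs\<close>. Hence the support conditions further on.\<close>

definition mk_word :: "'v list \<Rightarrow> (nat \<Rightarrow>\<^sub>0 nat) \<Rightarrow> ('v \<times> nat) list" where
  "mk_word vs e = map (\<lambda>s. (vs ! s, lookup e s)) [0..<length vs]"

definition degree_below :: "nat \<Rightarrow> (nat \<Rightarrow>\<^sub>0 nat) \<Rightarrow> nat" where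
  "degree_below n e = (\<Sum>s<n. lookup e s)"

lemma lookup_word_exp: "lookup (word_exp w) s = (if s < length w then snd (w ! s) else 0)"
  by (simp add: word_exp_def nth.rep_eq nth_default_def)

lemma keys_word_exp: "keys (word_exp w) \<subseteq> {..<length w}"
  by (auto simp: in_keys_iff lookup_word_exp split: if_splits)

lemma length_mk_word [simp]: "length (mk_word vs e) = length vs"
  by (simp add: mk_word_def)

lemma map_fst_mk_word [simp]: "map fst (mk_word vs e) = vs"
  by (simp add: mk_word_def comp_def map_nth)

lemma mk_word_word_exp: "mk_word (map fst w) (word_exp w) = w"
  by (rule nth_equalityI) (simp_all add: mk_word_def lookup_word_exp)

lemma word_exp_mk_word: "keys e \<subseteq> {..<length vs} \<Longrightarrow> word_exp (mk_word vs e) = e"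
  by (rule poly_mapping_eqI) (auto simp: lookup_word_exp mk_word_def in_keys_iff)

lemma word_exp_swap:
  "word_exp (u @ y # x # v) = swap_exp (length u) (word_exp (u @ x # y # v))"
  by (rule poly_mapping_eqI)
    (auto simp: lookup_word_exp lookup_swap_exp nth_append nth_Cons' Transposition.transpose_def)

lemma word_exp_adjacent:
  "word_exp (u @ (i, a) # (j, b) # v) = word_exp (u @ (i, 0) # (j, 0) # v)
     + Poly_Mapping.single (length u) a + Poly_Mapping.single (Suc (length u)) b"
  by (rule poly_mapping_eqI)
    (auto simp: lookup_word_exp nth_append nth_Cons' lookup_add lookup_single when_def)

lemma degree_below_add: "degree_below n (a + b) = degree_below n a + degree_below n b"
  by (simp add: degree_below_def lookup_add sum.distrib)

lemma degree_below_single: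
  "degree_below n (Poly_Mapping.single s k) = (if s < n then k else 0)"
  by (simp add: degree_below_def lookup_single when_def)

lemma degree_below_sum: "degree_below n (sum f A) = (\<Sum>i\<in>A. degree_below n (f i))"
  by (induction A rule: infinite_finite_induct) (simp_all add: degree_below_add, simp_all add: degree_below_def)

lemma degree_below_word_exp: "degree_below (length w) (word_exp w) = sum_list (map snd w)"
  by (simp add: degree_below_def lookup_word_exp sum_list_sum_nth atLeast0LessThan)

lemma sum_list_mk_word: "sum_list (map snd (mk_word vs e)) = degree_below (length vs) e"
  by (simp add: mk_word_def degree_below_def comp_def interv_sum_list_conv_sum_set_nat
      atLeast0LessThan)

lemma finite_exponents: "finite {e. keys e \<subseteq> {..<n} \<and> degree_below n e = K}"
proof (rule finite_subset)
  let ?L = "{xs. set xs \<subseteq> {..K} \<and> length xs = n}"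
  show "{e. keys e \<subseteq> {..<n} \<and> degree_below n e = K} \<subseteq> Poly_Mapping.nth ` ?L"
  proof
    fix e assume e: "e \<in> {e. keys e \<subseteq> {..<n} \<and> degree_below n e = K}"
    have "e = Poly_Mapping.nth (map (lookup e) [0..<n])"
      using e by (intro poly_mapping_eqI) (auto simp: nth.rep_eq nth_default_def in_keys_iff)
    moreover have "lookup e s \<le> K" if "s < n" for s
      using e that member_le_sum[of s "{..<n}" "lookup e"] by (auto simp: degree_below_def)
    ultimately show "e \<in> Poly_Mapping.nth ` ?L"
      by (intro image_eqI[where x = "map (lookup e) [0..<n]"]) auto
  qed
  show "finite (Poly_Mapping.nth ` ?L)"
    by (intro finite_imageI finite_lists_length_eq) simp
qed


subsection \<open>Functionals vanishing on the relations\<close>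

lemma finite_pairs [simp]: "finite {(s, t). s < t \<and> t < (n::nat)}"
  by (rule finite_subset[of _ "{..<n} \<times> {..<n}"]) auto

text \<open>The signs \<open>c\<close> make up for the difference between the sign \<open>(-1)\<^bsup>m i i * m j j\<^esup>\<close> of the commutation
  relations and the sign \<open>(-1)\<^bsup>m i j\<^esup>\<close> by which \<open>(x\<^sub>s - x\<^sub>t)\<^bsup>m i j\<^esup>\<close> changes under a transposition.\<close>

locale super_factors =
  fixes m :: "'v \<Rightarrow> 'v \<Rightarrow> nat" and c :: "'v \<Rightarrow> 'v \<Rightarrow> rat"
  assumes m_sym: "m i j = m j i"
    and c_square: "c i j * c i j = 1"
    and c_cocycle: "c i j * c j i = (-1) ^ (m i i * m j j + m i j)"
begin

definition kills :: "(('v \<times> nat) list \<Rightarrow> rat) \<Rightarrow> bool" where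
  "kills \<phi> \<longleftrightarrow>
     (\<forall>u v i j a b. \<phi> (u @ (j, b) # (i, a) # v) = (-1) ^ (m i i * m j j) * \<phi> (u @ (i, a) # (j, b) # v))
   \<and> (\<forall>u v i j k p. p < m i j \<longrightarrow>
        (\<Sum>l\<le>k. of_nat (l choose p) * \<phi> (u @ (i, k - l) # (j, l) # v)) = 0)"

lemma kills_swap:
  assumes "kills \<phi>"
  shows "\<phi> (u @ (i, a) # (j, b) # v) = (-1) ^ (m j j * m i i) * \<phi> (u @ (j, b) # (i, a) # v)"
  using assms unfolding kills_def by blast

lemma kills_arrow:
  assumes "kills \<phi>" "p < m i j"
  shows "(\<Sum>l\<le>k. of_nat (l choose p) * \<phi> (u @ (i, k - l) # (j, l) # v)) = 0"
  using assms unfolding kills_def by blast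

definition coherent :: "('v list \<Rightarrow> rat mpoly) \<Rightarrow> bool" where
  "coherent G \<longleftrightarrow>
     (\<forall>us i j ws. swap_poly (length us) (G (us @ i # j # ws)) = G (us @ j # i # ws))"

definition admissible :: "('v list \<Rightarrow> rat mpoly) \<Rightarrow> bool" where
  "admissible F \<longleftrightarrow>
     (\<forall>us i j ws.
        swap_poly (length us) (F (us @ i # j # ws)) = (-1) ^ (m i i * m j j) * F (us @ j # i # ws)
      \<and> (var (length us) - var (Suc (length us))) ^ m i j dvd F (us @ i # j # ws))"

definition word_coeff :: "('v list \<Rightarrow> rat mpoly) \<Rightarrow> ('v \<times> nat) list \<Rightarrow> rat" where
  "word_coeff F w = lookup (F (map fst w)) (word_exp w)"

text \<open>Coherence makes a coefficient depend only on the multiset of letters; this is why orbits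
  of exponents are indexed by multisets.\<close>

lemma word_coeff_coherent:
  assumes "coherent G" "mset w = mset w'"
  shows "word_coeff G w' = word_coeff G w"
  using assms(2) refl[of "word_coeff G w"]
proof (induction rule: mset_adjacent_induct[where P = "\<lambda>w'. word_coeff G w' = word_coeff G w"])
  case (swap u x y v)
  have "G (map fst u @ fst y # fst x # map fst v)
      = swap_poly (length (map fst u)) (G (map fst u @ fst x # fst y # map fst v))"
    using assms(1) by (simp only: coherent_def)
  then have "word_coeff G (u @ y # x # v) = word_coeff G (u @ x # y # v)"
    by (simp add: word_coeff_def word_exp_swap[of u y] lookup_swap_poly)
  with swap show ?case by simp
qed

lemma kills_word_coeff:
  assumes "admissible F"
  shows "kills (word_coeff F)"
  unfolding kills_def
proof (intro conjI allI impI)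
  fix u v :: "('v \<times> nat) list" and i j a b
  let ?F = "F (map fst u @ i # j # map fst v)" and ?F' = "F (map fst u @ j # i # map fst v)"
  have "swap_poly (length (map fst u)) ?F = (-1) ^ (m i i * m j j) * ?F'"
    using assms by (simp only: admissible_def)
  then have "lookup (swap_poly (length u) ?F) e = lookup ((-1) ^ (m i i * m j j) * ?F') e" for e
    by simp
  then have "lookup ?F (swap_exp (length u) e) = (-1) ^ (m i i * m j j) * lookup ?F' e" for e
    unfolding lookup_swap_poly lookup_minus_one_power_times .
  from this[of "word_exp (u @ (j, b) # (i, a) # v)"]
  have "(-1) ^ (m i i * m j j) * word_coeff F (u @ (j, b) # (i, a) # v)
      = word_coeff F (u @ (i, a) # (j, b) # v)"
    by (simp add: word_coeff_def word_exp_swap[of u "(j, b)"])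
  then show "word_coeff F (u @ (j, b) # (i, a) # v)
      = (-1) ^ (m i i * m j j) * word_coeff F (u @ (i, a) # (j, b) # v)"
    by (cases "even (m i i * m j j)") auto
next
  fix u v :: "('v \<times> nat) list" and i j k p
  assume "p < m i j"
  let ?s = "length u"
  let ?e = "word_exp (u @ (i, 0) # (j, 0) # v)"
  have "(var (length (map fst u)) - var (Suc (length (map fst u)))) ^ m i j
      dvd F (map fst u @ i # j # map fst v)"
    using assms by (simp only: admissible_def)
  then have "(var ?s - var (Suc ?s)) ^ m i j dvd F (map fst u @ i # j # map fst v)"
    by simp
  moreover have "lookup ?e ?s = 0" "lookup ?e (Suc ?s) = 0"
    by (simp_all add: lookup_word_exp nth_append)
  ultimately have "diag_coeff ?s (Suc ?s) p ?e k (F (map fst u @ i # j # map fst v)) = 0"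
    using \<open>p < m i j\<close> by (simp add: var_diff_power_dvd_iff)
  moreover have exp: "word_exp (u @ (i, k - l) # (j, l) # v)
      = ?e + Poly_Mapping.single ?s (k - l) + Poly_Mapping.single (Suc ?s) l" for l
    by (rule word_exp_adjacent)
  ultimately show "(\<Sum>l\<le>k. of_nat (l choose p) * word_coeff F (u @ (i, k - l) # (j, l) # v)) = 0"
    by (simp add: diag_coeff_def word_coeff_def exp)
qed

text \<open>On all words of shape \<open>vs\<close> a functional is in general a formal power
  series. Fixing the total label \<open>K\<close> cuts out a polynomial and respects the relations,
  each of which is homogeneous in the total label.\<close>

definition poly_of_functional :: "(('v \<times> nat) list \<Rightarrow> rat) \<Rightarrow> nat \<Rightarrow> 'v list \<Rightarrow> rat mpoly" where
  "poly_of_functional \<phi> K vs =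
     (\<Sum>e | keys e \<subseteq> {..<length vs} \<and> degree_below (length vs) e = K.
        Poly_Mapping.single e (\<phi> (mk_word vs e)))"

lemma lookup_poly_of_functional:
  "lookup (poly_of_functional \<phi> K vs) e =
    (if keys e \<subseteq> {..<length vs} \<and> degree_below (length vs) e = K then \<phi> (mk_word vs e) else 0)"
  by (simp add: poly_of_functional_def lookup_sum lookup_single when_def finite_exponents sum.If_cases)

lemma lookup_poly_of_functional_word_exp:
  "lookup (poly_of_functional \<phi> K (map fst w)) (word_exp w) =
    (if sum_list (map snd w) = K then \<phi> w else 0)"
  using keys_word_exp[of w]
  by (simp add: lookup_poly_of_functional mk_word_word_exp degree_below_word_exp)

lemma word_coeff_poly_of_functional:
  "sum_list (map snd w) = K \<Longrightarrow> word_coeff (poly_of_functional \<phi> K) w = \<phi> w"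
  by (simp add: word_coeff_def lookup_poly_of_functional_word_exp)

lemma mk_word_split:
  assumes "keys e \<subseteq> {..<length (us @ i # j # ws)}"
  obtains u v where "map fst u = us" "map fst v = ws"
    "e = word_exp (u @ (i, lookup e (length us)) # (j, lookup e (Suc (length us))) # v)"
proof -
  let ?w = "mk_word (us @ i # j # ws) e"
  have "map fst ?w = us @ i # j # ws" by simp
  then obtain u x y v where w: "?w = u @ x # y # v"
    and uv: "map fst u = us" "fst x = i" "fst y = j" "map fst v = ws"
    by (auto simp: map_eq_append_conv map_eq_Cons_conv simp del: map_fst_mk_word)
  have e: "e = word_exp (u @ x # y # v)"
    using word_exp_mk_word[OF assms] w by simp
  moreover have "lookup e (length us) = snd x" "lookup e (Suc (length us)) = snd y"
    using uv(1) by (simp_all add: e lookup_word_exp nth_append flip: uv(1))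
  ultimately show ?thesis
    using uv that[of u v] by auto
qed

lemma admissible_poly_of_functional:
  assumes "kills \<phi>"
  shows "admissible (poly_of_functional \<phi> K)"
  unfolding admissible_def
proof (intro allI conjI)
  fix us i j ws
  let ?F = "poly_of_functional \<phi> K (us @ i # j # ws)"
    and ?F' = "poly_of_functional \<phi> K (us @ j # i # ws)"
  let ?s = "length us" and ?n = "length (us @ i # j # ws)"
  show "swap_poly ?s ?F = (-1) ^ (m i i * m j j) * ?F'"
  proof (rule poly_mapping_eqI)
    fix e
    show "lookup (swap_poly ?s ?F) e = lookup ((-1) ^ (m i i * m j j) * ?F') e"
    proof (cases "keys e \<subseteq> {..<?n}")
      case True
      then have "keys e \<subseteq> {..<length (us @ j # i # ws)}" by simp
      then obtain u v where uv: "map fst u = us" "map fst v = ws"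
        and "e = word_exp (u @ (j, lookup e ?s) # (i, lookup e (Suc ?s)) # v)"
        by (rule mk_word_split)
      then obtain a b where e: "e = word_exp (u @ (j, a) # (i, b) # v)" by blast
      have e': "swap_exp ?s e = word_exp (u @ (i, b) # (j, a) # v)"
        using word_exp_swap[of u "(i, b)" "(j, a)" v] arg_cong[OF uv(1), of length] by (simp add: e)
      have F: "lookup ?F (word_exp (u @ (i, b) # (j, a) # v))
          = (if sum_list (map snd (u @ (i, b) # (j, a) # v)) = K
             then \<phi> (u @ (i, b) # (j, a) # v) else 0)"
        using lookup_poly_of_functional_word_exp[of \<phi> K "u @ (i, b) # (j, a) # v"] by (simp add: uv)
      have F': "lookup ?F' (word_exp (u @ (j, a) # (i, b) # v))
          = (if sum_list (map snd (u @ (i, b) # (j, a) # v)) = K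
             then \<phi> (u @ (j, a) # (i, b) # v) else 0)"
        using lookup_poly_of_functional_word_exp[of \<phi> K "u @ (j, a) # (i, b) # v"]
        by (simp add: uv ac_simps)
      have "\<phi> (u @ (i, b) # (j, a) # v) = (-1) ^ (m i i * m j j) * \<phi> (u @ (j, a) # (i, b) # v)"
        using kills_swap[OF assms, of u i b j a v] by (subst mult.commute[of "m i i"])
      then show ?thesis
        unfolding lookup_swap_poly lookup_minus_one_power_times e' F unfolding e F' by simp
    next
      case False
      have "\<not> keys (swap_exp ?s e) \<subseteq> {..<?n}"
        using keys_swap_exp[of "swap_exp ?s e" ?n ?s] False by auto
      with False show ?thesis
        by (simp add: lookup_swap_poly lookup_minus_one_power_times lookup_poly_of_functional)
    qed
  qed
  have "diag_coeff ?s (Suc ?s) p e k ?F = 0"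
    if "p < m i j" "lookup e ?s = 0" "lookup e (Suc ?s) = 0" for p k and e :: "nat \<Rightarrow>\<^sub>0 nat"
  proof -
    let ?e = "\<lambda>l. e + Poly_Mapping.single ?s (k - l) + Poly_Mapping.single (Suc ?s) l"
    show ?thesis
    proof (cases "keys e \<subseteq> {..<?n} \<and> degree_below ?n e + k = K")
      case False
      have "keys e \<subseteq> keys (?e l)" for l
        by (auto simp: in_keys_iff lookup_add)
      moreover have "degree_below ?n (?e l) = degree_below ?n e + k" if "l \<le> k" for l
        using that by (simp add: degree_below_add degree_below_single)
      ultimately have "\<not> (keys (?e l) \<subseteq> {..<?n} \<and> degree_below ?n (?e l) = K)" if "l \<le> k" for l
        using that False by (metis subset_trans)
      then have "lookup ?F (?e l) = 0" if "l \<le> k" for l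
        using that by (simp only: lookup_poly_of_functional if_False)
      then show ?thesis by (simp add: diag_coeff_def)
    next
      case True
      then have "keys e \<subseteq> {..<?n}" ..
      then obtain u v where uv: "map fst u = us" "map fst v = ws"
        and "e = word_exp (u @ (i, lookup e ?s) # (j, lookup e (Suc ?s)) # v)"
        by (rule mk_word_split)
      with that(2,3) have e: "e = word_exp (u @ (i, 0) # (j, 0) # v)" by simp
      have "?e l = word_exp (u @ (i, k - l) # (j, l) # v)" for l
        unfolding e word_exp_adjacent[of u i "k - l"] using uv by auto
      moreover have "lookup ?F (word_exp (u @ (i, k - l) # (j, l) # v))
          = \<phi> (u @ (i, k - l) # (j, l) # v)" if "l \<le> k" for l
      proof -
        have "sum_list (map snd (u @ (i, k - l) # (j, l) # v))
            = sum_list (map snd (u @ (i, 0) # (j, 0) # v)) + k"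
          using that by simp
        also have "\<dots> = K"
          using True degree_below_word_exp[of "u @ (i, 0) # (j, 0) # v"]
          by (simp add: e flip: uv)
        finally have "word_coeff (poly_of_functional \<phi> K) (u @ (i, k - l) # (j, l) # v)
            = \<phi> (u @ (i, k - l) # (j, l) # v)"
          by (rule word_coeff_poly_of_functional)
        then show ?thesis by (simp add: word_coeff_def uv)
      qed
      ultimately have "diag_coeff ?s (Suc ?s) p e k ?F
          = (\<Sum>l\<le>k. of_nat (l choose p) * \<phi> (u @ (i, k - l) # (j, l) # v))"
        unfolding diag_coeff_def by simp
      then show ?thesis
        using kills_arrow[OF assms \<open>p < m i j\<close>] by simp
    qed
  qed
  then show "(var ?s - var (Suc ?s)) ^ m i j dvd ?F"
    by (simp add: var_diff_power_dvd_iff)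
qed

subsection \<open>The common divisor of admissible families\<close>

definition factor :: "'v list \<Rightarrow> nat \<Rightarrow> nat \<Rightarrow> rat mpoly" where
  "factor vs s t =
     Poly_Mapping.single 0 (c (vs ! s) (vs ! t)) * (var s - var t) ^ m (vs ! s) (vs ! t)"

definition divisor :: "'v list \<Rightarrow> rat mpoly" where
  "divisor vs = (\<Prod>(s, t) | s < t \<and> t < length vs. factor vs s t)"

definition divisor_exp :: "'v list \<Rightarrow> (nat \<Rightarrow>\<^sub>0 nat)" where
  "divisor_exp vs =
     (\<Sum>(s, t) | s < t \<and> t < length vs. Poly_Mapping.single s (m (vs ! s) (vs ! t)))"

lemma c_neq_zero [simp]: "c i j \<noteq> 0"
  using c_square[of i j] by auto

lemma factor_neq_zero: "s < t \<Longrightarrow> factor vs s t \<noteq> 0"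
  by (simp add: factor_def)

lemma divisor_neq_zero: "divisor vs \<noteq> 0"
  by (auto simp: divisor_def factor_neq_zero)

lemma lead_monom_factor:
  assumes "s < t"
  shows "lead_monom (factor vs s t) = Poly_Mapping.single s (m (vs ! s) (vs ! t))"
proof -
  have "(\<Sum>i<k. Poly_Mapping.single s (1::nat)) = Poly_Mapping.single s k" for k
    by (induction k) (simp_all del: sum_constant flip: single_add)
  then show ?thesis
    using assms by (simp del: sum_constant add: factor_def lead_monom_mult lead_monom_power lead_monom_var_diff)
qed

lemma lead_monom_divisor: "lead_monom (divisor vs) = divisor_exp vs"
  unfolding divisor_def divisor_exp_def
  by (subst lead_monom_prod) (auto simp: factor_neq_zero lead_monom_factor intro!: sum.cong)

lemma keys_divisor_exp: "keys (divisor_exp vs) \<subseteq> {..<length vs}"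
proof
  fix x assume "x \<in> keys (divisor_exp vs)"
  then have "lookup (divisor_exp vs) x \<noteq> 0"
    by (simp add: in_keys_iff)
  then have "(\<Sum>p | fst p < snd p \<and> snd p < length vs.
      lookup (Poly_Mapping.single (fst p) (m (vs ! fst p) (vs ! snd p))) x) \<noteq> 0"
    by (simp add: divisor_exp_def lookup_sum case_prod_unfold)
  then obtain p where "fst p < snd p" "snd p < length vs"
      "lookup (Poly_Mapping.single (fst p) (m (vs ! fst p) (vs ! snd p))) x \<noteq> 0"
    by (metis (mono_tags, lifting) mem_Collect_eq sum.neutral)
  then show "x \<in> {..<length vs}"
    by (auto simp: lookup_single when_def split: if_splits)
qed

lemma degree_divisor_exp:
  "degree_below (length vs) (divisor_exp vs)
    = (\<Sum>(s, t) | s < t \<and> t < length vs. m (vs ! s) (vs ! t))"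
  unfolding divisor_exp_def
  by (subst degree_below_sum) (auto simp: degree_below_single intro!: sum.cong)

text \<open>Reversing the difference contributes \<open>(-1)^{m_ij}\<close>, and the constants
  contribute \<open>(-1)^{m_ii m_jj + m_ij}\<close> by the two laws for \<open>c\<close>. What
  remains is the sign of the commutation relations.\<close>

lemma factor_commute:
  "factor vs t s = (-1) ^ (m (vs ! s) (vs ! s) * m (vs ! t) (vs ! t)) * factor vs s t"
proof -
  let ?i = "vs ! s" and ?j = "vs ! t"
  have "c ?j ?i = c ?i ?j * c ?i ?j * c ?j ?i"
    by (simp add: c_square)
  also have "\<dots> = c ?i ?j * (-1) ^ (m ?i ?i * m ?j ?j + m ?i ?j)"
    by (simp add: c_cocycle mult.assoc)
  finally have c: "c ?j ?i = (-1) ^ (m ?i ?i * m ?j ?j + m ?i ?j) * c ?i ?j"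
    by simp
  have v: "(var t - var s) ^ m ?j ?i = (-1) ^ m ?i ?j * (var s - var t :: rat mpoly) ^ m ?i ?j"
    by (metis m_sym minus_diff_eq mult_minus1 power_mult_distrib)
  have sgn: "Poly_Mapping.single 0 ((-1) ^ k * a) = ((-1) ^ k :: rat mpoly) * Poly_Mapping.single 0 a"
    for k and a :: rat
    by (cases "even k") (simp_all add: single_uminus)
  have sq: "((-1) ^ k :: rat mpoly) * (-1) ^ k = 1" for k
    by (cases "even k") simp_all
  have const: "Poly_Mapping.single 0 (c ?j ?i) = (-1) ^ (m ?i ?i * m ?j ?j) * (-1) ^ m ?i ?j
      * (Poly_Mapping.single 0 (c ?i ?j) :: rat mpoly)"
    unfolding c sgn by (simp add: power_add)
  have "factor vs t s = (-1) ^ (m ?i ?i * m ?j ?j)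
      * (Poly_Mapping.single 0 (c ?i ?j) * (var s - var t) ^ m ?i ?j)
      * ((-1) ^ m ?i ?j * (-1) ^ m ?i ?j)"
    unfolding factor_def v const by (simp only: ac_simps)
  then show ?thesis
    by (simp only: sq factor_def mult_1_right)
qed

text \<open>The transposition permutes the pairs of positions and preserves the order within each
  pair except the pair of the two neighbours. That single reversed factor produces the whole
  sign.\<close>

lemma swap_poly_divisor:
  "swap_poly (length us) (divisor (us @ i # j # ws))
    = (-1) ^ (m i i * m j j) * divisor (us @ j # i # ws)"
proof -
  let ?s = "length us"
  let ?vs = "us @ i # j # ws" and ?vs' = "us @ j # i # ws"
  let ?\<tau> = "Transposition.transpose ?s (Suc ?s)"
  let ?P = "{(s, t). s < t \<and> t < length ?vs}" and ?p = "(?s, Suc ?s)"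
  have nth: "?vs' ! ?\<tau> x = ?vs ! x" for x
    by (cases "x = ?s \<or> x = Suc ?s") (auto simp: nth_append nth_Cons')
  have factor: "swap_poly ?s (factor ?vs a b) = factor ?vs' (?\<tau> a) (?\<tau> b)" for a b
    unfolding factor_def nth
    by (simp add: swap_poly_mult swap_poly_const swap_poly_power swap_poly_diff swap_poly_var)
  have p: "?p \<in> ?P" by auto
  have "swap_poly ?s (divisor ?vs) = (\<Prod>(a, b)\<in>?P. factor ?vs' (?\<tau> a) (?\<tau> b))"
    by (simp add: divisor_def swap_poly_prod case_prod_unfold factor)
  also have "\<dots> = factor ?vs' (Suc ?s) ?s * (\<Prod>(a, b)\<in>?P - {?p}. factor ?vs' (?\<tau> a) (?\<tau> b))"
    by (subst prod.remove[OF _ p]) simp_all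
  also have "(\<Prod>(a, b)\<in>?P - {?p}. factor ?vs' (?\<tau> a) (?\<tau> b)) = (\<Prod>(a, b)\<in>?P - {?p}. factor ?vs' a b)"
  proof (rule prod.reindex_bij_witness[of _ "map_prod ?\<tau> ?\<tau>" "map_prod ?\<tau> ?\<tau>"])
    fix q assume q: "q \<in> ?P - {?p}"
    obtain a b where ab: "q = (a, b)" "a < b" "b < length ?vs" "(a, b) \<noteq> ?p"
      using q by auto
    then have "?\<tau> a < ?\<tau> b" "?\<tau> b < length ?vs" "(?\<tau> a, ?\<tau> b) \<noteq> ?p"
      by (auto simp: Transposition.transpose_def)
    then show "map_prod ?\<tau> ?\<tau> q \<in> ?P - {?p}" "map_prod ?\<tau> ?\<tau> q \<in> ?P - {?p}"
      by (auto simp: ab)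
  qed auto
  also have "factor ?vs' (Suc ?s) ?s * \<dots>
      = (-1) ^ (m i i * m j j) * (factor ?vs' ?s (Suc ?s) * (\<Prod>(a, b)\<in>?P - {?p}. factor ?vs' a b))"
    by (subst factor_commute) (simp add: nth_append mult.commute[of "m j j"] mult.assoc)
  also have "factor ?vs' ?s (Suc ?s) * (\<Prod>(a, b)\<in>?P - {?p}. factor ?vs' a b) = divisor ?vs'"
    unfolding divisor_def using prod.remove[OF _ p, of "\<lambda>(a, b). factor ?vs' a b"] by simp
  finally show ?thesis .
qed

text \<open>Admissibility speaks of neighbours only. For a distant pair the right-hand vertex is
  exchanged with its left neighbour until it stands next to position \<open>s\<close>; each exchange
  permutes variables and changes a sign, which carries the divisibility back.\<close>

lemma admissible_dvd:
  assumes "admissible F" "s < t" "t < length vs"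
  shows "(var s - var t) ^ m (vs ! s) (vs ! t) dvd F vs"
  using assms(2,3)
proof (induction t arbitrary: vs)
  case (Suc t)
  define us ws where "us = take t vs" and "ws = drop (Suc (Suc t)) vs"
  have len: "length us = t"
    using Suc.prems by (simp add: us_def)
  have vs: "vs = us @ vs ! t # vs ! Suc t # ws"
    using Suc.prems by (simp add: us_def ws_def Cons_nth_drop_Suc)
  show ?case
  proof (cases "s = t")
    case True
    then show ?thesis
      using assms(1) len unfolding admissible_def by (metis vs)
  next
    case False
    let ?vs' = "us @ vs ! Suc t # vs ! t # ws"
    have "s < t" using Suc.prems False by simp
    then have "(var s - var t) ^ m (?vs' ! s) (?vs' ! t) dvd F ?vs'"
      by (intro Suc.IH) (simp_all add: len)
    moreover have "?vs' ! s = vs ! s" "?vs' ! t = vs ! Suc t"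
      using \<open>s < t\<close> Suc.prems len by (simp_all add: nth_append us_def)
    ultimately have "swap_poly t ((var s - var t) ^ m (vs ! s) (vs ! Suc t)) dvd swap_poly t (F ?vs')"
      by (simp add: swap_poly_dvd)
    moreover have "swap_poly t (F ?vs') = (-1) ^ (m (vs ! Suc t) (vs ! Suc t) * m (vs ! t) (vs ! t)) * F vs"
      using assms(1) len unfolding admissible_def by (metis vs)
    ultimately show ?thesis
      using \<open>s < t\<close>
      by (cases "even (m (vs ! Suc t) (vs ! Suc t) * m (vs ! t) (vs ! t))")
        (simp_all add: swap_poly_power swap_poly_diff swap_poly_var)
  qed
qed simp

text \<open>Under a transposition \<open>F\<close> and \<open>divisor\<close> acquire the same sign,
  so it cancels in the cofactor, which is symmetric and not merely symmetric up to sign.\<close>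

lemma admissible_factorization:
  assumes "admissible F"
  obtains G where "\<And>vs. F vs = divisor vs * G vs" "coherent G"
proof -
  have "divisor vs dvd F vs" for vs
    unfolding divisor_def factor_def
    by (rule prod_var_diff_dvd)
      (auto simp: admissible_dvd[OF assms] mult_single c_square)
  then have "\<forall>vs. \<exists>g. F vs = divisor vs * g"
    by (simp add: dvd_def)
  then have "\<exists>G. \<forall>vs. F vs = divisor vs * G vs"
    by (rule choice)
  then obtain G where "\<forall>vs. F vs = divisor vs * G vs" ..
  then have G: "F vs = divisor vs * G vs" for vs ..
  have "swap_poly (length us) (G (us @ i # j # ws)) = G (us @ j # i # ws)" for us i j ws
  proof -
    let ?e = "(-1) ^ (m i i * m j j) :: rat mpoly"
    have "swap_poly (length us) (F (us @ i # j # ws)) = ?e * F (us @ j # i # ws)"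
      using assms by (simp only: admissible_def)
    then have "?e * divisor (us @ j # i # ws) * swap_poly (length us) (G (us @ i # j # ws))
        = ?e * divisor (us @ j # i # ws) * G (us @ j # i # ws)"
      by (simp only: G swap_poly_mult swap_poly_divisor mult.assoc)
    then show ?thesis
      using divisor_neq_zero[of "us @ j # i # ws"] by simp
  qed
  then have "coherent G"
    by (simp add: coherent_def)
  with G show ?thesis
    by (rule that)
qed

lemma admissible_divisor_mult:
  assumes "coherent G"
  shows "admissible (\<lambda>vs. divisor vs * G vs)"
  unfolding admissible_def
proof (intro allI conjI)
  fix us ws :: "'v list" and i j
  let ?s = "length us" and ?vs = "us @ i # j # ws"
  show "swap_poly ?s (divisor ?vs * G ?vs)
      = (-1) ^ (m i i * m j j) * (divisor (us @ j # i # ws) * G (us @ j # i # ws))"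
    using assms by (simp only: coherent_def swap_poly_mult swap_poly_divisor mult.assoc)
  have "factor ?vs ?s (Suc ?s) dvd divisor ?vs"
    unfolding divisor_def
    using dvd_prodI[of "{(s, t). s < t \<and> t < length ?vs}" "(?s, Suc ?s)" "\<lambda>(s, t). factor ?vs s t"]
    by simp
  moreover have "(var ?s - var (Suc ?s)) ^ m i j dvd factor ?vs ?s (Suc ?s)"
    by (simp add: factor_def nth_append)
  ultimately show "(var ?s - var (Suc ?s)) ^ m i j dvd divisor ?vs * G ?vs"
    by (meson dvd_mult2 dvd_trans)
qed


subsection \<open>Orbit sums and normal words\<close>

text \<open>As only the largest element of an orbit matters, \<open>vs\<close> need not be sorted and no explicit
  description of that element is necessary.\<close>

definition orbit :: "'v list \<Rightarrow> ('v \<times> nat) multiset \<Rightarrow> (nat \<Rightarrow>\<^sub>0 nat) set" where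
  "orbit vs M = {e. keys e \<subseteq> {..<length vs} \<and> mset (mk_word vs e) = M}"

definition orbit_sum :: "('v \<times> nat) multiset \<Rightarrow> 'v list \<Rightarrow> rat mpoly" where
  "orbit_sum M vs = (\<Sum>e\<in>orbit vs M. Poly_Mapping.single e 1)"

definition normal_word :: "'v list \<Rightarrow> ('v \<times> nat) multiset \<Rightarrow> ('v \<times> nat) list" where
  "normal_word vs M = mk_word vs (divisor_exp vs + Max (orbit vs M))"

lemma finite_orbit: "finite (orbit vs M)"
proof -
  obtain w where w: "mset w = M"
    using ex_mset by blast
  have "orbit vs M \<subseteq> word_exp ` {w'. mset w' = mset w}"
  proof
    fix e assume "e \<in> orbit vs M"
    then show "e \<in> word_exp ` {w'. mset w' = mset w}"
      by (intro image_eqI[of _ _ "mk_word vs e"]) (simp_all add: orbit_def w word_exp_mk_word)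
  qed
  then show ?thesis
    by (rule finite_subset) (intro finite_imageI mset_eq_finite)
qed

lemma ex_mset_map_fst:
  assumes "image_mset fst M = mset vs"
  shows "\<exists>w. mset w = M \<and> map fst w = vs"
  using assms
proof (induction vs arbitrary: M)
  case (Cons x vs)
  then obtain p where p: "p \<in># M" "x = fst p"
    by (metis (no_types, lifting) image_iff list.set_intros(1) set_image_mset set_mset_mset)
  then obtain N where N: "M = add_mset p N"
    by (meson mset_add)
  then obtain w where "mset w = N" "map fst w = vs"
    using Cons p by auto
  then show ?case
    by (intro exI[of _ "p # w"]) (simp add: N p)
qed simp

lemma orbit_nonempty:
  assumes "image_mset fst M = mset vs"
  shows "orbit vs M \<noteq> {}"
proof -
  obtain w where "mset w = M" "map fst w = vs"
    using ex_mset_map_fst[OF assms] by blast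
  then have "word_exp w \<in> orbit vs M"
    using keys_word_exp[of w] mk_word_word_exp[of w] by (auto simp: orbit_def)
  then show ?thesis by blast
qed

lemma Max_orbit_in: "image_mset fst M = mset vs \<Longrightarrow> Max (orbit vs M) \<in> orbit vs M"
  by (simp add: finite_orbit orbit_nonempty)

lemma mset_mk_word_Max_orbit:
  "image_mset fst M = mset vs \<Longrightarrow> mset (mk_word vs (Max (orbit vs M))) = M"
  using Max_orbit_in[of M vs] by (simp add: orbit_def)

lemma lookup_orbit_sum: "lookup (orbit_sum M vs) e = (if e \<in> orbit vs M then 1 else 0)"
  by (simp add: orbit_sum_def lookup_sum lookup_single when_def finite_orbit)

lemma keys_orbit_sum: "keys (orbit_sum M vs) = orbit vs M"
  by (auto simp: in_keys_iff lookup_orbit_sum split: if_splits)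

lemma swap_exp_in_orbit:
  assumes "e \<in> orbit (us @ i # j # ws) M"
  shows "swap_exp (length us) e \<in> orbit (us @ j # i # ws) M"
proof -
  have keys: "keys e \<subseteq> {..<length (us @ i # j # ws)}"
    and M: "mset (mk_word (us @ i # j # ws) e) = M"
    using assms by (simp_all add: orbit_def)
  obtain u v where uv: "map fst u = us" "map fst v = ws"
    and "e = word_exp (u @ (i, lookup e (length us)) # (j, lookup e (Suc (length us))) # v)"
    using keys by (rule mk_word_split)
  then obtain a b where e: "e = word_exp (u @ (i, a) # (j, b) # v)"
    by blast
  have w: "mk_word (us @ i # j # ws) e = u @ (i, a) # (j, b) # v"
    using mk_word_word_exp[of "u @ (i, a) # (j, b) # v"] by (simp add: uv e)
  have e': "swap_exp (length us) e = word_exp (u @ (j, b) # (i, a) # v)"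
    using word_exp_swap[of u "(j, b)" "(i, a)" v] arg_cong[OF uv(1), of length] by (simp add: e)
  have "mk_word (us @ j # i # ws) (swap_exp (length us) e) = u @ (j, b) # (i, a) # v"
    unfolding e' using mk_word_word_exp[of "u @ (j, b) # (i, a) # v"] by (simp add: uv)
  then show ?thesis
    using M w keys keys_swap_exp[OF keys, of "length us"]
    by (simp add: orbit_def add_mset_commute)
qed

lemma coherent_orbit_sum: "coherent (orbit_sum M)"
  unfolding coherent_def
proof (intro allI poly_mapping_eqI)
  fix us ws :: "'v list" and i j e
  have "swap_exp (length us) e \<in> orbit (us @ i # j # ws) M \<longleftrightarrow> e \<in> orbit (us @ j # i # ws) M"
    using swap_exp_in_orbit[of e us j i ws M] swap_exp_in_orbit[of "swap_exp (length us) e" us i j ws M]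
    by auto
  then show "lookup (swap_poly (length us) (orbit_sum M (us @ i # j # ws))) e
      = lookup (orbit_sum M (us @ j # i # ws)) e"
    by (simp add: lookup_swap_poly lookup_orbit_sum)
qed

definition dual_functional :: "('v \<times> nat) multiset \<Rightarrow> ('v \<times> nat) list \<Rightarrow> rat" where
  "dual_functional M = word_coeff (\<lambda>vs. divisor vs * orbit_sum M vs)"

lemma kills_dual_functional: "kills (dual_functional M)"
  unfolding dual_functional_def
  by (intro kills_word_coeff admissible_divisor_mult coherent_orbit_sum)

lemma map_fst_normal_word [simp]: "map fst (normal_word vs M) = vs"
  by (simp add: normal_word_def)

lemma word_exp_normal_word:
  assumes "image_mset fst M = mset vs"
  shows "word_exp (normal_word vs M) = divisor_exp vs + Max (orbit vs M)"
  unfolding normal_word_def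
proof (rule word_exp_mk_word)
  have "keys (Max (orbit vs M)) \<subseteq> {..<length vs}"
    using Max_orbit_in[OF assms] by (simp add: orbit_def)
  then show "keys (divisor_exp vs + Max (orbit vs M)) \<subseteq> {..<length vs}"
    using keys_divisor_exp[of vs] Poly_Mapping.keys_add[of "divisor_exp vs" "Max (orbit vs M)"] by blast
qed

text \<open>The value at a normal word is a coefficient of the divisor times an orbit sum. For
  \<open>M\<close> itself it is the leading coefficient; for \<open>N\<close> it can be nonzero only
  if the exponent of that word is at most the leading one, and the exponent of the divisor cancels
  from this comparison.\<close>

lemma dual_functional_normal_word:
  assumes "image_mset fst M = mset vs" "image_mset fst N = mset vs"
  shows "dual_functional M (normal_word vs M) \<noteq> 0"
    and "dual_functional M (normal_word vs N) \<noteq> 0 \<Longrightarrow> Max (orbit vs N) \<le> Max (orbit vs M)"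
proof -
  let ?F = "divisor vs * orbit_sum M vs"
  have "orbit_sum M vs \<noteq> 0"
    using orbit_nonempty[OF assms(1)] keys_orbit_sum[of M vs] by auto
  then have "?F \<noteq> 0" and lead: "lead_monom ?F = divisor_exp vs + Max (orbit vs M)"
    by (simp_all add: divisor_neq_zero lead_monom_mult lead_monom_divisor)
      (simp add: lead_monom_def keys_orbit_sum)
  have dual: "dual_functional M (normal_word vs K) = lookup ?F (divisor_exp vs + Max (orbit vs K))"
    if "image_mset fst K = mset vs" for K
    by (simp add: dual_functional_def word_coeff_def word_exp_normal_word[OF that])
  show "dual_functional M (normal_word vs M) \<noteq> 0"
    using lead_monom_in_keys[OF \<open>?F \<noteq> 0\<close>] by (simp add: dual assms(1) lead in_keys_iff)
  assume "dual_functional M (normal_word vs N) \<noteq> 0"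
  then have "divisor_exp vs + Max (orbit vs N) \<in> keys ?F"
    by (simp add: dual assms(2) in_keys_iff)
  then have "divisor_exp vs + Max (orbit vs N) \<le> divisor_exp vs + Max (orbit vs M)"
    using le_lead_monom lead by metis
  then show "Max (orbit vs N) \<le> Max (orbit vs M)"
    by simp
qed

lemma Max_orbit_inject:
  assumes "image_mset fst M = mset vs" "image_mset fst N = mset vs"
    and "Max (orbit vs M) = Max (orbit vs N)"
  shows "M = N"
  by (metis assms mset_mk_word_Max_orbit)

text \<open>The degree of the divisor is the excess of the total label of a normal word over that of
  the multiset indexing it. It ends up in the numerator of the Poincare series.\<close>

lemma sum_normal_word:
  assumes "image_mset fst M = mset vs"
  shows "sum_list (map snd (normal_word vs M))
    = degree_below (length vs) (divisor_exp vs) + \<Sum>\<^sub># (image_mset snd M)"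
proof -
  have "\<Sum>\<^sub># (image_mset snd M) = sum_list (map snd (mk_word vs (Max (orbit vs M))))"
    by (metis assms mset_map mset_mk_word_Max_orbit sum_mset_sum_list)
  then show ?thesis
    by (simp add: normal_word_def sum_list_mk_word degree_below_add)
qed

text \<open>The leading exponent of the polynomial of \<open>\<phi>\<close> is that of a normal word, because the
  cofactor of the divisor has constant coefficients on orbits.\<close>

lemma kills_nonzero_normal_word:
  assumes \<phi>: "kills \<phi>" "\<phi> w \<noteq> 0" and vs: "mset (map fst w) = mset vs"
  shows "\<exists>M. image_mset fst M = mset vs
    \<and> sum_list (map snd (normal_word vs M)) = sum_list (map snd w) \<and> \<phi> (normal_word vs M) \<noteq> 0"
proof -
  define K where "K = sum_list (map snd w)"
  define F where "F = poly_of_functional \<phi> K"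
  have adm: "admissible F"
    unfolding F_def by (rule admissible_poly_of_functional[OF \<phi>(1)])
  then obtain G where G: "\<And>vs. F vs = divisor vs * G vs" "coherent G"
    by (rule admissible_factorization) blast
  have "word_coeff F w = \<phi> w"
    by (simp add: F_def K_def word_coeff_poly_of_functional)
  then have "F (map fst w) \<noteq> 0"
    using \<phi>(2) by (auto simp: word_coeff_def)
  \<comment> \<open>Adjacent transpositions act invertibly, so nonvanishing passes from the shape of
    \<open>w\<close> to its rearrangement \<open>vs\<close>.\<close>
  with vs have F0: "F vs \<noteq> 0"
  proof (induction rule: mset_adjacent_induct)
    case (swap us i j ws)
    have "swap_poly (length us) (F (us @ i # j # ws)) = (-1) ^ (m i i * m j j) * F (us @ j # i # ws)"
      using adm by (simp only: admissible_def)
    moreover have "swap_poly (length us) (F (us @ i # j # ws)) \<noteq> 0"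
      using swap by (metis push_zero swap_poly_def swap_poly_swap_poly)
    ultimately show ?case by auto
  qed
  then have G0: "G vs \<noteq> 0"
    by (auto simp: G(1))
  have lead: "lead_monom (F vs) = divisor_exp vs + lead_monom (G vs)"
    by (simp add: G(1) lead_monom_mult divisor_neq_zero G0 lead_monom_divisor)
  have "lookup (F vs) (lead_monom (F vs)) \<noteq> 0"
    using lead_monom_in_keys[OF F0] by (simp add: in_keys_iff)
  then have keys_lead: "keys (lead_monom (F vs)) \<subseteq> {..<length vs}"
    and deg_lead: "degree_below (length vs) (lead_monom (F vs)) = K"
    and \<phi>_lead: "\<phi> (mk_word vs (lead_monom (F vs))) \<noteq> 0"
    by (auto simp: F_def lookup_poly_of_functional split: if_splits)
  define M where "M = mset (mk_word vs (lead_monom (G vs)))"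
  have fst_M: "image_mset fst M = mset vs"
    unfolding M_def by (metis map_fst_mk_word mset_map)
  have keys_G: "keys (lead_monom (G vs)) \<subseteq> {..<length vs}"
  proof -
    have "keys (lead_monom (G vs)) \<subseteq> keys (lead_monom (F vs))"
      by (auto simp: lead in_keys_iff lookup_add)
    with keys_lead show ?thesis by blast
  qed
  \<comment> \<open>\<open>G\<close> is constant on the orbit, so along with its leading exponent
    every exponent of that orbit occurs in \<open>G vs\<close>; the leading one must be the largest
    of them.\<close>
  have "Max (orbit vs M) = lead_monom (G vs)"
  proof (rule Max_eqI[OF finite_orbit])
    show "lead_monom (G vs) \<in> orbit vs M"
      using keys_G by (simp add: orbit_def M_def)
    fix e assume e: "e \<in> orbit vs M"
    then have "word_coeff G (mk_word vs e) = word_coeff G (mk_word vs (lead_monom (G vs)))"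
      by (intro word_coeff_coherent[OF G(2)]) (simp add: orbit_def M_def)
    then have "lookup (G vs) e = lookup (G vs) (lead_monom (G vs))"
      using e keys_G by (simp add: word_coeff_def word_exp_mk_word orbit_def)
    then have "e \<in> keys (G vs)"
      using lead_monom_in_keys[OF G0] by (simp add: in_keys_iff)
    then show "e \<le> lead_monom (G vs)"
      by (rule le_lead_monom)
  qed
  then have "normal_word vs M = mk_word vs (lead_monom (F vs))"
    by (simp add: normal_word_def lead)
  then show ?thesis
    using fst_M \<phi>_lead deg_lead by (intro exI[of _ M]) (simp add: sum_list_mk_word K_def)
qed

end


section \<open>Counting labelled multisets\<close>

text \<open>For a single vertex with multiplicity \<open>n\<close> these are the partitions of
  \<open>N\<close> into at most \<open>n\<close> parts, which are counted by
  \<open>1 / (q)_n\<close>.\<close>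

definition labellings :: "'v multiset \<Rightarrow> nat \<Rightarrow> ('v \<times> nat) multiset set" where
  "labellings D N = {M. image_mset fst M = D \<and> \<Sum>\<^sub># (image_mset snd M) = N}"

lemma finite_labellings: "finite (labellings D N)"
proof (rule finite_subset)
  let ?L = "{w. set w \<subseteq> set_mset D \<times> {..N} \<and> length w = size D}"
  show "labellings D N \<subseteq> mset ` ?L"
  proof
    fix M assume M: "M \<in> labellings D N"
    obtain w where w: "mset w = M"
      using ex_mset by blast
    have "k \<le> N" if "(i, k) \<in># M" for i k
    proof -
      from that obtain M' where "M = add_mset (i, k) M'"
        by (meson mset_add)
      then show ?thesis
        using M by (auto simp: labellings_def)
    qed
    moreover have "i \<in># D" if "(i, k) \<in># M" for i k
      using M that by (force simp: labellings_def)
    moreover have "length w = size D"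
      using M by (metis (mono_tags, lifting) labellings_def mem_Collect_eq size_image_mset size_mset w)
    ultimately show "M \<in> mset ` ?L"
      using w by (intro image_eqI[of _ _ w]) auto
  qed
  show "finite (mset ` ?L)"
    by (intro finite_imageI finite_lists_length_eq) simp
qed

lemma labellings_empty: "labellings {#} N = (if N = 0 then {{#}} else {})"
  by (auto simp: labellings_def)

definition shift_label :: "'v \<Rightarrow> 'v \<times> nat \<Rightarrow> 'v \<times> nat" where
  "shift_label i p = (if fst p = i then (fst p, Suc (snd p)) else p)"

lemma inj_shift_label: "inj (shift_label i)"
  by (rule injI) (auto simp: shift_label_def prod_eq_iff split: if_splits)

lemma fst_shift_label: "image_mset fst (image_mset (shift_label i) M) = image_mset fst M"
  unfolding image_mset.compositionality
  by (rule image_mset_cong) (simp add: shift_label_def)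

lemma sum_shift_label:
  "\<Sum>\<^sub># (image_mset snd (image_mset (shift_label i) M))
    = \<Sum>\<^sub># (image_mset snd M) + count (image_mset fst M) i"
  by (induction M) (auto simp: shift_label_def)

lemma labellings_without_zero:
  "{M \<in> labellings D N. (i, 0) \<notin># M} =
    (if count D i \<le> N then image_mset (shift_label i) ` labellings D (N - count D i) else {})"
proof -
  have "\<exists>M'. M = image_mset (shift_label i) M'" if "(i, 0) \<notin># M" for M
  proof
    \<comment> \<open>Lowering the labels at \<open>i\<close> undoes the shift; the truncated
      subtraction is harmless because the label 0 is excluded there.\<close>
    have "image_mset (shift_label i \<circ> (\<lambda>p. if fst p = i then (fst p, snd p - 1) else p)) M
        = image_mset id M"
    proof (rule image_mset_cong)
      fix p assume "p \<in># M"
      with that have "p \<noteq> (i, 0)" by blast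
      then show "(shift_label i \<circ> (\<lambda>p. if fst p = i then (fst p, snd p - 1) else p)) p = id p"
        by (cases p) (auto simp: shift_label_def)
    qed
    then show "M = image_mset (shift_label i)
        (image_mset (\<lambda>p. if fst p = i then (fst p, snd p - 1) else p) M)"
      by (simp add: image_mset.compositionality)
  qed
  moreover have "(i, 0) \<notin># image_mset (shift_label i) M'" for M'
    by (auto simp: shift_label_def split: if_splits)
  moreover have "image_mset (shift_label i) M' \<in> labellings D N
      \<longleftrightarrow> count D i \<le> N \<and> M' \<in> labellings D (N - count D i)" for M'
    unfolding labellings_def mem_Collect_eq sum_shift_label fst_shift_label by auto
  ultimately show ?thesis
    by (auto simp: image_iff) blast+
qed

lemma labellings_with_zero:
  "{M \<in> labellings (add_mset i D) N. (i, 0) \<in># M} = add_mset (i, 0) ` labellings D N"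
proof -
  have "M \<in> add_mset (i, 0) ` labellings D N"
    if M: "M \<in> labellings (add_mset i D) N" "(i, 0) \<in># M" for M
  proof -
    obtain M' where "M = add_mset (i, 0) M'"
      using M(2) by (meson mset_add)
    with M(1) show ?thesis
      by (auto simp: labellings_def)
  qed
  then show ?thesis
    by (auto simp: labellings_def)
qed

text \<open>Either the label \<open>0\<close> occurs at \<open>i\<close>, or all labels at \<open>i\<close> can be decreased by \<open>1\<close>.\<close>

lemma card_labellings_add_mset:
  fixes i :: 'v
  defines "r D \<equiv> count D i + 1"
  shows "card (labellings (add_mset i D) N) = card (labellings D N)
    + (if r D \<le> N then card (labellings (add_mset i D) (N - r D)) else 0)"
proof -
  let ?L = "labellings (add_mset i D) N"
  have "?L = {M \<in> ?L. (i, 0) \<in># M} \<union> {M \<in> ?L. (i, 0) \<notin># M}"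
    by blast
  then have "card ?L = card {M \<in> ?L. (i, 0) \<in># M} + card {M \<in> ?L. (i, 0) \<notin># M}"
    using finite_labellings[of "add_mset i D" N]
    by (metis (no_types, lifting) card_Un_disjoint disjoint_iff finite_Un mem_Collect_eq)
  moreover have "card {M \<in> ?L. (i, 0) \<in># M} = card (labellings D N)"
    unfolding labellings_with_zero by (intro card_image inj_onI) simp
  moreover have "card (image_mset (shift_label i) ` A) = card A" for A :: "('v \<times> nat) multiset set"
    using multiset.inj_map[OF inj_shift_label[of i]] by (metis card_image inj_on_subset subset_UNIV)
  ultimately show ?thesis
    unfolding labellings_without_zero by (simp add: r_def)
qed

text \<open>The series is in \<open>q\<^sup>1\<^sup>/\<^sup>2\<close>, so that total label \<open>N\<close> is recorded by the coefficient of index \<open>2N\<close>.\<close>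

definition labelling_series :: "'v multiset \<Rightarrow> rat fps" where
  "labelling_series D =
     Abs_fps (\<lambda>n. if even n then of_nat (card (labellings D (n div 2))) else 0)"

text \<open>The recursion for the cardinalities as an identity of series: lowering the total label
  by \<open>r\<close> corresponds to the factor \<open>q^r = X^{2r}\<close>.\<close>

lemma labelling_series_add_mset:
  "(1 - (fps_X ^ 2) ^ (count D i + 1)) * labelling_series (add_mset i D) = labelling_series D"
proof (rule fps_ext)
  fix n
  let ?r = "count D i + 1"
  have "((1 - (fps_X ^ 2) ^ ?r) * labelling_series (add_mset i D)) $ n
      = labelling_series (add_mset i D) $ n
        - (if n < 2 * ?r then 0 else labelling_series (add_mset i D) $ (n - 2 * ?r))"
    by (simp only: left_diff_distrib power_mult[symmetric] fps_sub_nth fps_X_power_mult_nth mult_1_left)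
  also have "\<dots> = labelling_series D $ n"
  proof (cases "even n")
    case True
    then obtain N where n: "n = 2 * N" by blast
    have "(2 * N - 2 * ?r) div 2 = N - ?r"
      by (metis diff_mult_distrib2 nonzero_mult_div_cancel_left zero_neq_numeral)
    then show ?thesis
      unfolding n labelling_series_def using card_labellings_add_mset[of i D N] by auto
  next
    case False
    then show ?thesis
      by (auto simp: labelling_series_def)
  qed
  finally show "((1 - (fps_X ^ 2) ^ ?r) * labelling_series (add_mset i D)) $ n = labelling_series D $ n" .
qed

lemma q_pochhammer_0 [simp]: "q_pochhammer q 0 = 1"
  by (simp add: q_pochhammer_def)

lemma q_pochhammer_Suc: "q_pochhammer q (Suc n) = q_pochhammer q n * (1 - q ^ Suc n)"
  by (simp add: q_pochhammer_def)

text \<open>A further copy of \<open>i\<close> multiplies the product by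
  \<open>1 - q^{count D i + 1}\<close> and leaves the factors of the other vertices alone; the
  recursion removes exactly this factor.\<close>

lemma labelling_series_times_q_pochhammer:
  assumes "finite V" "set_mset D \<subseteq> V"
  shows "labelling_series D * (\<Prod>i\<in>V. q_pochhammer (fps_X ^ 2) (count D i)) = 1"
  using assms(2)
proof (induction D)
  case empty
  show ?case
    by (auto simp: labelling_series_def labellings_empty fps_eq_iff)
next
  case (add i D)
  let ?p = "\<lambda>D j. q_pochhammer (fps_X ^ 2 :: rat fps) (count D j)"
  have i: "i \<in> V" using add.prems by simp
  have "(\<Prod>j\<in>V. ?p (add_mset i D) j) = ?p (add_mset i D) i * (\<Prod>j\<in>V - {i}. ?p D j)"
    by (subst prod.remove[OF \<open>finite V\<close> i], rule arg_cong[of _ _ "(*) _"], rule prod.cong) auto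
  also have "\<dots> = (1 - (fps_X ^ 2) ^ (count D i + 1)) * (\<Prod>j\<in>V. ?p D j)"
    by (subst prod.remove[OF \<open>finite V\<close> i, of "?p D"]) (simp add: q_pochhammer_Suc mult_ac)
  finally have "labelling_series (add_mset i D) * (\<Prod>j\<in>V. ?p (add_mset i D) j)
      = ((1 - (fps_X ^ 2) ^ (count D i + 1)) * labelling_series (add_mset i D)) * (\<Prod>j\<in>V. ?p D j)"
    by (simp only: mult_ac)
  then show ?case
    using add by (simp only: labelling_series_add_mset) simp
qed


section \<open>The two sides as rational functions\<close>

lemma q_half_neq_0: "q_half \<noteq> 0"
  by (simp add: q_half_def Zero_fract_def eq_fract)

text \<open>With \<open>q = x^2\<close> each factor satisfies
  \<open>1 - q^{-r} = - q^{-r} (1 - q^r)\<close>. The correction \<open>(-1)^n q^{n(n+1)/2}\<close>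
  is written as \<open>x^n (-x)^{n^2}\<close> because the rescaling of the variables supplies the
  first power and the squares in the Euler form supply the second.\<close>

lemma q_pochhammer_inverse:
  fixes x :: "'a::field"
  assumes "x \<noteq> 0"
  shows "q_pochhammer (inverse (x ^ 2)) n * (x ^ n * (- x) ^ (n * n)) = q_pochhammer (x ^ 2) n"
proof (induction n)
  case (Suc n)
  have step: "(1 - inverse (x ^ 2) ^ Suc n) * (x * (- x) ^ (2 * n + 1)) = 1 - (x ^ 2) ^ Suc n"
  proof -
    have "x * (- x) ^ (2 * n + 1) = - ((x ^ 2) ^ Suc n)"
      by (simp add: power_mult power2_eq_square)
    then show ?thesis
      using assms by (simp only: power_inverse) (simp add: algebra_simps)
  qed
  have "x ^ Suc n * (- x) ^ (Suc n * Suc n) = (x ^ n * (- x) ^ (n * n)) * (x * (- x) ^ (2 * n + 1))"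
  proof -
    have "Suc n * Suc n = n * n + (2 * n + 1)" by simp
    then show ?thesis by (simp only: power_add power_Suc mult_ac)
  qed
  then have "q_pochhammer (inverse (x ^ 2)) (Suc n) * (x ^ Suc n * (- x) ^ (Suc n * Suc n))
      = q_pochhammer (inverse (x ^ 2)) n * (x ^ n * (- x) ^ (n * n))
        * ((1 - inverse (x ^ 2) ^ Suc n) * (x * (- x) ^ (2 * n + 1)))"
    by (simp only: q_pochhammer_Suc mult_ac)
  then show ?case
    by (simp only: Suc step q_pochhammer_Suc)
qed simp

definition arrow_form :: "('v, 'e) pre_digraph \<Rightarrow> ('v \<Rightarrow>\<^sub>0 nat) \<Rightarrow> nat" where
  "arrow_form Q d = (\<Sum>i\<in>verts Q. \<Sum>j\<in>verts Q. num_arrows Q i j * lookup d i * lookup d j)"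

text \<open>The closed form of the Poincare series. With \<open>q\<close> in place of
  \<open>q^{-1}\<close> the denominators are invertible power series, so the expansion in
  \<open>q^{1/2}\<close> can be read off.\<close>

definition poincare_coeff :: "('v, 'e) pre_digraph \<Rightarrow> ('v \<Rightarrow>\<^sub>0 nat) \<Rightarrow> ratfun" where
  "poincare_coeff Q d =
     (if keys d \<subseteq> verts Q
      then (- q_half) ^ arrow_form Q d / (\<Prod>i\<in>verts Q. q_pochhammer q_var (lookup d i))
      else 0)"

lemma lookup_exponent_weight: "lookup (exponent_weight d) i = int (lookup d i)"
  by (simp add: map.rep_eq when_def)

lemma motivic_series_eq_rescale:
  assumes "finite (verts Q)"
  shows "motivic_series Q = rescale_variables q_half (poincare_coeff Q)"
proof
  fix d
  show "motivic_series Q d = rescale_variables q_half (poincare_coeff Q) d"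
  proof (cases "keys d \<subseteq> verts Q")
    case True
    let ?S = "\<Sum>i\<in>verts Q. lookup d i * lookup d i"
    let ?p = "\<Prod>i\<in>verts Q. q_pochhammer q_var (lookup d i)"
    let ?p' = "\<Prod>i\<in>verts Q. q_pochhammer (inverse q_var) (lookup d i)"
    have "(\<Prod>i\<in>verts Q. q_half ^ lookup d i) = q_half ^ (\<Sum>i\<in>keys d. lookup d i)"
      unfolding power_sum[symmetric]
      by (rule arg_cong[of _ _ "power q_half"], rule sum.mono_neutral_right)
        (use assms True in \<open>auto simp: in_keys_iff\<close>)
    moreover have "?p' * ((\<Prod>i\<in>verts Q. q_half ^ lookup d i) * (- q_half) ^ ?S) = ?p"
      unfolding power_sum prod.distrib[symmetric]
      by (simp only: q_pochhammer_inverse[OF q_half_neq_0])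
    ultimately have p: "?p' * (q_half ^ (\<Sum>i\<in>keys d. lookup d i) * (- q_half) ^ ?S) = ?p"
      by simp
    have "euler_form Q (exponent_weight d) (exponent_weight d) = int ?S - int (arrow_form Q d)"
      by (simp add: euler_form_def arrow_form_def lookup_exponent_weight)
    moreover have "(- q_half) powi (- (int s - int e)) = (- q_half) ^ e / (- q_half) ^ s" for s e
      using q_half_neq_0 by (simp add: power_int_diff)
    ultimately have "(- q_half) powi (- euler_form Q (exponent_weight d) (exponent_weight d))
        = (- q_half) ^ arrow_form Q d / (- q_half) ^ ?S"
      by (simp only:)
    moreover have "a / s / p' = x * (a / (p' * (x * s)))" if "x \<noteq> 0" for a s p' x :: ratfun
      using that by simp
    ultimately show ?thesis
      using True q_half_neq_0
      by (simp add: motivic_series_def rescale_variables_def poincare_coeff_def flip: p)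
  qed (simp add: motivic_series_def rescale_variables_def poincare_coeff_def)
qed

section \<open>Laurent expansion of the closed form\<close>

lemma Fract_prod:
  "(\<Prod>i\<in>A. Fract (f i) 1) = Fract (prod f A) (1 :: 'a::idom)"
  by (induction A rule: infinite_finite_induct) (simp_all add: One_fract_def)

lemma Fract_power: "Fract a 1 ^ n = Fract (a ^ n) (1 :: 'a::idom)"
  by (induction n) (simp_all add: One_fract_def)

lemma Fract_q_pochhammer: "q_pochhammer (Fract a 1) n = Fract (q_pochhammer a n) (1 :: 'a::idom)"
  unfolding q_pochhammer_def Fract_prod[symmetric] Fract_power
  by (simp add: One_fract_def)

lemma fps_of_poly_q_pochhammer:
  "fps_of_poly (q_pochhammer a n) = q_pochhammer (fps_of_poly (a :: rat poly)) n"
  by (simp add: q_pochhammer_def fps_of_poly_prod fps_of_poly_diff fps_of_poly_power)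

text \<open>The labelling series is the inverse of the denominator, so the expansion is that series
  times \<open>(-X)^E\<close> with \<open>E = arrow_form Q d\<close>. Here \<open>D\<close> is
  \<open>d\<close> read as a multiset of vertices.\<close>

lemma fls_nth_laurent_expansion_poincare_coeff:
  assumes "finite (verts Q)" "keys d \<subseteq> verts Q" and D: "\<And>i. count D i = lookup d i"
  shows "fls_nth (laurent_expansion (poincare_coeff Q d)) n =
    (if n < int (arrow_form Q d) then 0
     else (-1) ^ arrow_form Q d * labelling_series D $ nat (n - int (arrow_form Q d)))"
proof -
  let ?E = "arrow_form Q d" and ?X = "[:0, 1:] :: rat poly"
  define a where "a = (- ?X) ^ ?E"
  define b where "b = (\<Prod>i\<in>verts Q. q_pochhammer (?X ^ 2) (lookup d i))"
  have X: "fps_of_poly ?X = fps_X"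
    by (simp add: fps_of_poly_pCons)
  have "set_mset D \<subseteq> verts Q"
    using assms(2) D by (auto simp: in_keys_iff simp flip: count_greater_zero_iff)
  then have b: "labelling_series D * fps_of_poly b = 1"
    using labelling_series_times_q_pochhammer[OF assms(1), of D, unfolded D]
    by (simp add: b_def fps_of_poly_prod fps_of_poly_q_pochhammer fps_of_poly_power X)
  then have "b \<noteq> 0" by auto
  have a: "fps_of_poly a = (-1) ^ ?E * fps_X ^ ?E"
    by (simp only: a_def fps_of_poly_power fps_of_poly_uminus X power_minus[of fps_X])
  have "poincare_coeff Q d = Fract a b"
  proof -
    have q: "q_var = Fract (?X ^ 2) 1" "- q_half = Fract (- ?X) 1"
      by (simp_all add: q_half_def Fract_power)
    show ?thesis
      using assms(2) unfolding poincare_coeff_def q Fract_q_pochhammer Fract_prod Fract_power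
      by (simp add: a_def b_def)
  qed
  then have "laurent_expansion (poincare_coeff Q d) = fps_to_fls (fps_of_poly a) / fps_to_fls (fps_of_poly b)"
    using laurent_expansion_Fract[OF \<open>b \<noteq> 0\<close>] by simp
  also have "\<dots> = fps_to_fls (fps_of_poly a * labelling_series D)"
  proof -
    have "fps_to_fls (fps_of_poly a * labelling_series D) * fps_to_fls (fps_of_poly b)
        = fps_to_fls (fps_of_poly a * (labelling_series D * fps_of_poly b))"
      by (simp add: fls_times_fps_to_fls mult.assoc)
    also have "\<dots> = fps_to_fls (fps_of_poly a)"
      by (simp add: b)
    finally have "fps_to_fls (fps_of_poly a * labelling_series D) * fps_to_fls (fps_of_poly b)
        = fps_to_fls (fps_of_poly a)" .
    moreover have "fps_to_fls (fps_of_poly b) \<noteq> 0"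
      using b by auto
    ultimately show ?thesis
      by (metis nonzero_mult_div_cancel_right)
  qed
  finally have "fls_nth (laurent_expansion (poincare_coeff Q d)) n
      = (if n < 0 then 0 else (fps_of_poly a * labelling_series D) $ nat n)"
    by simp
  also have "fps_of_poly a * labelling_series D = (-1) ^ ?E * (fps_X ^ ?E * labelling_series D)"
    by (simp only: a mult.assoc)
  also have "(if n < 0 then 0 else ((-1) ^ ?E * (fps_X ^ ?E * labelling_series D)) $ nat n)
      = (if n < int ?E then 0 else (-1) ^ ?E * labelling_series D $ nat (n - int ?E))"
    by (cases "even ?E") (auto simp: fps_X_power_mult_nth nat_diff_distrib)
  finally show ?thesis .
qed


section \<open>The free algebra\<close>

lemma ring_free_algebra: "ring (free_algebra X)"
proof -
  let ?C = "{f :: 'a noncomm_poly. \<forall>w\<in>keys f. set (letters w) \<subseteq> X}"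
  let ?P = "\<lambda>f :: 'a noncomm_poly. \<forall>w\<in>keys f. set (letters w) \<subseteq> X"
  have closed_add: "?P f \<Longrightarrow> ?P g \<Longrightarrow> ?P (f + g)" for f g
    using Poly_Mapping.keys_add[of f g] by blast
  have closed_mult: "?P f \<Longrightarrow> ?P g \<Longrightarrow> ?P (f * g)" for f g
    using keys_mult[of f g] by (fastforce simp: plus_free_monoid_def)
  have closed_uminus: "?P f \<Longrightarrow> ?P (- f)" for f
    by (auto simp: in_keys_iff)
  let ?R = "\<lparr>carrier = {f. ?P f}, monoid.mult = (*), one = 1, zero = 0, add = (+)\<rparr>"
  have "abelian_group ?R"
  proof (rule abelian_groupI, goal_cases)
    case (1 x y)
    then show ?case using closed_add[of x y] by simp
  next
    case 2
    show ?case by simp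
  next
    case (3 x y z)
    show ?case by (simp add: add.assoc)
  next
    case (4 x y)
    show ?case by (simp add: add.commute)
  next
    case (5 x)
    show ?case by simp
  next
    case (6 x)
    then show ?case using closed_uminus[of x] by (intro bexI[of _ "- x"]) simp_all
  qed
  moreover have "Group.monoid ?R"
  proof (rule Group.monoidI, goal_cases)
    case (1 x y)
    then show ?case using closed_mult[of x y] by simp
  next
    case 2
    show ?case by (simp add: zero_free_monoid_def)
  qed (simp_all add: mult.assoc)
  ultimately show ?thesis
    unfolding free_algebra_def by (rule ringI) (simp_all add: distrib_left distrib_right)
qed

lemma free_algebra_simps [simp]:
  "\<zero>\<^bsub>free_algebra X\<^esub> = 0" "\<one>\<^bsub>free_algebra X\<^esub> = 1"
  "f \<oplus>\<^bsub>free_algebra X\<^esub> g = f + g" "f \<otimes>\<^bsub>free_algebra X\<^esub> g = f * g"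
  by (simp_all add: free_algebra_def)

lemma carrier_free_algebra:
  "f \<in> carrier (free_algebra X) \<longleftrightarrow> (\<forall>w\<in>keys f. set (letters w) \<subseteq> X)"
  by (simp add: free_algebra_def)

lemma uminus_free_algebra:
  assumes "f \<in> carrier (free_algebra X)"
  shows "\<ominus>\<^bsub>free_algebra X\<^esub> f = - f"
proof -
  interpret ring "free_algebra X" by (rule ring_free_algebra)
  have "- f \<in> carrier (free_algebra X)"
    using assms by (auto simp: carrier_free_algebra in_keys_iff)
  then show ?thesis
    using assms by (intro minus_equality) simp_all
qed

lemma minus_free_algebra:
  assumes "f \<in> carrier (free_algebra X)" "g \<in> carrier (free_algebra X)"
  shows "f \<ominus>\<^bsub>free_algebra X\<^esub> g = f - g"
  using assms by (simp add: a_minus_def uminus_free_algebra)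

section \<open>Scalars and words in the free algebra\<close>

abbreviation scalar :: "rat \<Rightarrow> 'a noncomm_poly" where
  "scalar c \<equiv> Poly_Mapping.single 0 c"

abbreviation word_poly :: "'a list \<Rightarrow> 'a noncomm_poly" where
  "word_poly w \<equiv> Poly_Mapping.single (Word w) 1"

lemma scalar_carrier [simp]: "scalar c \<in> carrier (free_algebra X)"
  by (simp add: carrier_free_algebra zero_free_monoid_def)

lemma word_poly_carrier [simp]: "word_poly w \<in> carrier (free_algebra X) \<longleftrightarrow> set w \<subseteq> X"
  by (simp add: carrier_free_algebra)

lemma word_plus [simp]: "Word u + Word v = Word (u @ v)"
  by (simp add: plus_free_monoid_def)

lemma word_poly_mult: "word_poly u * word_poly v = word_poly (u @ v)"
  by (simp add: mult_single)

lemma scalar_times_single: "scalar a * Poly_Mapping.single w b = Poly_Mapping.single w (a * b)"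
  by (simp add: mult_single)

lemma single_times_scalar: "Poly_Mapping.single w b * scalar a = Poly_Mapping.single w (b * a)"
  by (simp add: mult_single)

lemma generator_mult: "generator g * generator h = word_poly [g, h]"
  by (simp add: generator_def word_poly_mult)

lemma minus_one_power_times_single:
  "(-1) ^ n * Poly_Mapping.single w c = (Poly_Mapping.single w ((-1) ^ n * c) :: 'a noncomm_poly)"
  by (cases "even n") (simp_all add: single_uminus)

lemma single_carrier:
  "set w \<subseteq> X \<Longrightarrow> Poly_Mapping.single (Word w) c \<in> carrier (free_algebra X)"
  by (simp add: carrier_free_algebra)

lemma sum_carrier:
  assumes "\<And>i. i \<in> A \<Longrightarrow> F i \<in> carrier (free_algebra X)"
  shows "sum F A \<in> carrier (free_algebra X)"
proof -
  interpret ring "free_algebra X" by (rule ring_free_algebra)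
  show ?thesis
    using assms
  proof (induction A rule: infinite_finite_induct)
    case (insert x A)
    then show ?case using a_closed[of "F x" "sum F A"] by simp
  qed (simp_all add: carrier_free_algebra)
qed

lemma diff_carrier:
  "f \<in> carrier (free_algebra X) \<Longrightarrow> g \<in> carrier (free_algebra X) \<Longrightarrow> f - g \<in> carrier (free_algebra X)"
  using abelian_group.minus_closed[OF ring.is_abelian_group[OF ring_free_algebra]]
  by (metis minus_free_algebra)

lemma word_poly_sandwich:
  "word_poly u * Poly_Mapping.single (Word w) c * word_poly v = Poly_Mapping.single (Word (u @ w @ v)) c"
  by (simp add: mult_single)

lemma zero_carrier: "0 \<in> carrier (free_algebra X)"
  by (simp add: carrier_free_algebra)

section \<open>Linear functionals and the ideals they annihilate\<close>

definition functional :: "('a list \<Rightarrow> rat) \<Rightarrow> 'a noncomm_poly \<Rightarrow> rat" where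
  "functional \<phi> f = (\<Sum>w\<in>keys f. lookup f w * \<phi> (letters w))"

lemma functional_single [simp]: "functional \<phi> (Poly_Mapping.single w c) = c * \<phi> (letters w)"
  by (simp add: functional_def)

lemma functional_add: "functional \<phi> (f + g) = functional \<phi> f + functional \<phi> g"
proof -
  let ?A = "keys f \<union> keys g"
  have sup: "functional \<phi> h = (\<Sum>w\<in>?A. lookup h w * \<phi> (letters w))" if "keys h \<subseteq> ?A" for h
    unfolding functional_def using that
    by (intro sum.mono_neutral_left) (auto simp: in_keys_iff)
  have "keys (f + g) \<subseteq> ?A"
    by (rule Poly_Mapping.keys_add)
  then show ?thesis
    by (simp add: sup lookup_add distrib_right sum.distrib)
qed

lemma functional_zero [simp]: "functional \<phi> 0 = 0"
  by (simp add: functional_def)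

lemma functional_uminus: "functional \<phi> (- f) = - functional \<phi> f"
  using functional_add[of \<phi> f "- f"] by simp

lemma functional_diff: "functional \<phi> (f - g) = functional \<phi> f - functional \<phi> g"
  using functional_add[of \<phi> "f - g" g] by simp

lemma functional_sum: "functional \<phi> (sum F A) = (\<Sum>i\<in>A. functional \<phi> (F i))"
  by (induction A rule: infinite_finite_induct) (simp_all add: functional_add)

text \<open>Multiplying by arbitrary words on both sides before evaluating makes this a two-sided
  ideal and not just a kernel; empty \<open>u\<close> and \<open>v\<close> give vanishing at
  \<open>f\<close> itself.\<close>

definition annihilated :: "'a set \<Rightarrow> ('a list \<Rightarrow> rat) \<Rightarrow> 'a noncomm_poly set" where
  "annihilated X \<phi> = {f \<in> carrier (free_algebra X).
     \<forall>u v. functional \<phi> (word_poly u * f * word_poly v) = 0}"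

lemma ideal_annihilated: "ideal (annihilated X \<phi>) (free_algebra X)"
proof -
  interpret ring "free_algebra X" by (rule ring_free_algebra)
  have single_left: "functional \<phi> (word_poly u * (Poly_Mapping.single w c * f) * word_poly v) = 0"
    if "\<forall>u v. functional \<phi> (word_poly u * f * word_poly v) = 0" for u v w c f
  proof -
    have "functional \<phi> (scalar c * h) = c * functional \<phi> h" for h
      by (induction h rule: poly_mapping_single_induct)
        (simp_all add: scalar_times_single distrib_left functional_add)
    moreover have "word_poly u * (Poly_Mapping.single w c * f) * word_poly v
        = scalar c * (word_poly (u @ letters w) * f * word_poly v)"
      by (simp add: mult.assoc[symmetric] mult_single plus_free_monoid_def zero_free_monoid_def)
    ultimately show ?thesis using that by simp
  qed
  have single_right: "functional \<phi> (word_poly u * (f * Poly_Mapping.single w c) * word_poly v) = 0"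
    if "\<forall>u v. functional \<phi> (word_poly u * f * word_poly v) = 0" for u v w c f
  proof -
    have "functional \<phi> (h * scalar c) = functional \<phi> h * c" for h
      by (induction h rule: poly_mapping_single_induct)
        (simp_all add: single_times_scalar distrib_right functional_add)
    moreover have "word_poly u * (f * Poly_Mapping.single w c) * word_poly v
        = (word_poly u * f * word_poly (letters w @ v)) * scalar c"
      by (simp add: mult.assoc mult_single plus_free_monoid_def zero_free_monoid_def)
    ultimately show ?thesis using that by simp
  qed
  show ?thesis
  proof (rule idealI)
    show "ring (free_algebra X)" by (rule ring_free_algebra)
    show "subgroup (annihilated X \<phi>) (add_monoid (free_algebra X))"
    proof (rule add.subgroupI)
      have "0 \<in> annihilated X \<phi>"
        by (simp add: annihilated_def carrier_free_algebra)
      then show "annihilated X \<phi> \<noteq> {}" by blast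
    next
      fix f g assume fg: "f \<in> annihilated X \<phi>" "g \<in> annihilated X \<phi>"
      have "f + g \<in> carrier (free_algebra X)"
        using fg a_closed[of f g] by (simp add: annihilated_def)
      with fg show "f \<oplus>\<^bsub>free_algebra X\<^esub> g \<in> annihilated X \<phi>"
        by (simp add: annihilated_def distrib_left distrib_right functional_add)
    next
      fix f assume f: "f \<in> annihilated X \<phi>"
      then have "- f \<in> carrier (free_algebra X)"
        by (auto simp: annihilated_def carrier_free_algebra in_keys_iff)
      with f show "\<ominus>\<^bsub>free_algebra X\<^esub> f \<in> annihilated X \<phi>"
        by (simp add: annihilated_def uminus_free_algebra functional_uminus)
    qed (auto simp: annihilated_def)
  next
    fix f r assume f: "f \<in> annihilated X \<phi>" and r: "r \<in> carrier (free_algebra X)"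
    have "functional \<phi> (word_poly u * (r * f) * word_poly v) = 0" for u v
      using f single_left
      by (induction r rule: poly_mapping_single_induct)
        (auto simp: annihilated_def distrib_left distrib_right functional_add)
    then show "r \<otimes>\<^bsub>free_algebra X\<^esub> f \<in> annihilated X \<phi>"
      using f r m_closed[of r f] by (simp add: annihilated_def)
    have "functional \<phi> (word_poly u * (f * r) * word_poly v) = 0" for u v
      using f single_right
      by (induction r rule: poly_mapping_single_induct)
        (auto simp: annihilated_def distrib_left distrib_right functional_add)
    then show "f \<otimes>\<^bsub>free_algebra X\<^esub> r \<in> annihilated X \<phi>"
      using f r m_closed[of f r] by (simp add: annihilated_def)
  qed
qed

text \<open>A basis of \<open>T\<close> stays independent when \<open>x\<close> is added, so a
  linear map can be prescribed as 0 on the basis and 1 at \<open>x\<close>. This turns the spanning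
  claim into a statement about functionals.\<close>

lemma exists_separating_functional:
  fixes T :: "'a noncomm_poly set"
  assumes zero: "0 \<in> T" and add: "\<And>f g. f \<in> T \<Longrightarrow> g \<in> T \<Longrightarrow> f + g \<in> T"
    and scale: "\<And>c f. f \<in> T \<Longrightarrow> scalar c * f \<in> T" and "x \<notin> T"
  shows "\<exists>\<psi> :: 'a noncomm_poly \<Rightarrow> rat. (\<forall>f g. \<psi> (f + g) = \<psi> f + \<psi> g)
    \<and> (\<forall>c f. \<psi> (scalar c * f) = c * \<psi> f) \<and> (\<forall>f\<in>T. \<psi> f = 0) \<and> \<psi> x = 1"
proof -
  interpret vs: vector_space "\<lambda>c f. scalar c * f :: 'a noncomm_poly"
    by unfold_locales
      (simp_all add: distrib_left single_add distrib_right mult.assoc[symmetric] mult_single)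
  interpret rat: vector_space "(*) :: rat \<Rightarrow> rat \<Rightarrow> rat"
    by unfold_locales (simp_all add: algebra_simps)
  interpret pair: vector_space_pair "\<lambda>c f. scalar c * f :: 'a noncomm_poly" "(*) :: rat \<Rightarrow> rat \<Rightarrow> rat"
    by unfold_locales
  have "vs.subspace T"
    using zero add scale by (rule vs.subspaceI)
  obtain B where B: "B \<subseteq> T" "vs.independent B" "T \<subseteq> vs.span B"
    by (rule vs.maximal_independent_subset)
  have "vs.span B \<subseteq> T"
    using B(1) \<open>vs.subspace T\<close> by (rule vs.span_minimal)
  then have "x \<notin> vs.span B" "x \<notin> B"
    using \<open>x \<notin> T\<close> B(1) by auto
  then have "vs.independent (insert x B)"
    using B(2) by (intro vs.independent_insertI)
  then obtain \<psi> where \<psi>: "Vector_Spaces.linear (\<lambda>c f. scalar c * f) (*) \<psi>"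
    "\<forall>y\<in>insert x B. \<psi> y = (if y = x then 1 else 0)"
    using pair.linear_independent_extend[of "insert x B" "\<lambda>y. if y = x then 1 else 0"] by blast
  note hom = Vector_Spaces.linear.axioms(3)[OF \<psi>(1)]
  have on_B: "\<psi> y = 0" if "y \<in> B" for y
  proof -
    have "y \<noteq> x" using that \<open>x \<notin> B\<close> by blast
    then show ?thesis using \<psi>(2) that by simp
  qed
  have "\<psi> f = 0" if "f \<in> T" for f
    by (rule module_hom.eq_0_on_span[OF hom, of B, OF on_B])
      (use B(3) that in blast)+
  moreover have "\<psi> x = 1"
    using \<psi>(2) by simp
  ultimately show ?thesis
    using module_hom.add[OF hom] module_hom.scale[OF hom] by (intro exI[of _ \<psi>]) simp
qed


section \<open>The algebra of a quiver\<close>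

lemma ex_map_eq: "distinct xs \<Longrightarrow> length ys = length xs \<Longrightarrow> \<exists>g. map g xs = ys"
proof (induction xs arbitrary: ys)
  case (Cons x xs)
  then obtain y ys' where ys: "ys = y # ys'"
    by (cases ys) auto
  with Cons obtain g where "map g xs = ys'"
    by auto
  then show ?case
    using Cons.prems by (intro exI[of _ "g(x := y)"]) (auto simp: ys)
qed simp

lemma sum_list_mset_cong:
  fixes f :: "'b \<Rightarrow> nat"
  shows "mset xs = mset ys \<Longrightarrow> sum_list (map f xs) = sum_list (map f ys)"
  by (metis mset_map sum_mset_sum_list)

lemma sum_square_symmetric:
  fixes g :: "nat \<Rightarrow> nat \<Rightarrow> nat"
  assumes "\<And>s t. g s t = g t s"
  shows "(\<Sum>s<n. \<Sum>t<n. g s t) = 2 * (\<Sum>(s, t) | s < t \<and> t < n. g s t) + (\<Sum>s<n. g s s)"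
proof (induction n)
  case (Suc n)
  have "{(s, t). s < t \<and> t < Suc n} = {(s, t). s < t \<and> t < n} \<union> (\<lambda>s. (s, n)) ` {..<n}"
    by auto
  moreover have "{(s, t). s < t \<and> t < n} \<inter> (\<lambda>s. (s, n)) ` {..<n} = {}"
    by auto
  ultimately have "(\<Sum>(s, t) | s < t \<and> t < Suc n. g s t)
      = (\<Sum>(s, t) | s < t \<and> t < n. g s t) + (\<Sum>(s, t)\<in>(\<lambda>s. (s, n)) ` {..<n}. g s t)"
    using finite_pairs[of n] by (simp add: sum.union_disjoint)
  also have "(\<Sum>(s, t)\<in>(\<lambda>s. (s, n)) ` {..<n}. g s t) = (\<Sum>s<n. g s n)"
    by (subst sum.reindex) (auto intro: inj_onI)
  finally have pairs: "(\<Sum>(s, t) | s < t \<and> t < Suc n. g s t)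
      = (\<Sum>(s, t) | s < t \<and> t < n. g s t) + (\<Sum>s<n. g s n)" .
  have "(\<Sum>t<n. g n t) = (\<Sum>s<n. g s n)"
    by (rule sum.cong[OF refl assms])
  then show ?case
    unfolding pairs using Suc by (simp add: sum.distrib)
qed simp

locale finite_symmetric_quiver = fin_digraph Q for Q :: "('v, 'e) pre_digraph" +
  assumes sym_quiver: "symmetric_quiver Q"
begin

abbreviation "m \<equiv> num_arrows Q"

abbreviation "gens \<equiv> verts Q \<times> (UNIV :: nat set)"

text \<open>The divisors are built for all elements of the vertex type, so symmetry of
  \<open>m\<close> has to be extended beyond the quiver, where all numbers are 0.\<close>

lemma num_arrows_outside: "i \<notin> verts Q \<or> j \<notin> verts Q \<Longrightarrow> m i j = 0"
  unfolding num_arrows_def using tail_in_verts head_in_verts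
  by (intro card_eq_0_iff[THEN iffD2] disjI1) auto

lemma num_arrows_commute: "m i j = m j i"
  using sym_quiver num_arrows_outside by (metis symmetric_quiver_def)

text \<open>An arbitrary linear order on the vertices, used to decide which of the two orders of a
  pair carries the sign.\<close>

definition rank :: "'v \<Rightarrow> nat" where
  "rank = (SOME f. inj_on f (verts Q))"

lemma inj_on_rank: "inj_on rank (verts Q)"
  unfolding rank_def using finite_imp_inj_to_nat_seg[OF finite_verts] by (metis someI)

definition sign :: "'v \<Rightarrow> 'v \<Rightarrow> rat" where
  "sign i j = (if i \<in> verts Q \<and> j \<in> verts Q \<and> rank j < rank i
     then (-1) ^ (m i i * m j j + m i j) else 1)"

sublocale super_factors m sign
proof
  fix i j
  show "m i j = m j i" by (rule num_arrows_commute)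
  show "sign i j * sign i j = 1"
    by (simp add: sign_def flip: power_mult_distrib)
  show "sign i j * sign j i = (-1) ^ (m i i * m j j + m i j)"
  proof (cases "i \<in> verts Q \<and> j \<in> verts Q")
    case True
    then have "rank i = rank j \<longleftrightarrow> i = j"
      using inj_on_rank by (auto dest: inj_onD)
    \<comment> \<open>For \<open>i = j\<close> the required sign is 1, since
      \<open>m_ii^2 + m_ii\<close> is even; for distinct vertices it is carried by exactly one of
      the two factors.\<close>
    then consider "i = j" | "rank i < rank j" | "rank j < rank i"
      using True by linarith
    then show ?thesis
      using True by cases (auto simp: sign_def mult.commute num_arrows_commute[of j i])
  next
    case False
    then show ?thesis
      using num_arrows_outside by (auto simp: sign_def)
  qed
qed

section \<open>The relations in terms of words, and functionals on the quotient\<close>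

lemma commutation_relations_eq:
  "commutation_relations Q =
    {word_poly [(i, a), (j, b)] - Poly_Mapping.single (Word [(j, b), (i, a)]) ((-1) ^ (m i i * m j j))
      | i j a b. i \<in> verts Q \<and> j \<in> verts Q}"
  unfolding commutation_relations_def generator_mult minus_one_power_times_single by simp

lemma arrow_relations_eq:
  "arrow_relations Q =
    {(\<Sum>l\<le>k. Poly_Mapping.single (Word [(i, k - l), (j, l)]) (of_nat (l choose p)))
      | i j k p. i \<in> verts Q \<and> j \<in> verts Q \<and> p < m i j}"
proof -
  have "(\<Sum>(k\<^sub>1, k\<^sub>2) \<in> {(k\<^sub>1, k\<^sub>2). k\<^sub>1 + k\<^sub>2 = k}.
         of_nat (k\<^sub>2 choose p) * (generator (i, k\<^sub>1) * generator (j, k\<^sub>2)))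
      = (\<Sum>l\<le>k. Poly_Mapping.single (Word [(i, k - l), (j, l)]) (of_nat (l choose p)))"
    for i j :: 'v and k p
  proof (rule sum.reindex_bij_witness[of _ "\<lambda>l. (k - l, l)" snd])
    fix x assume x: "x \<in> {(k\<^sub>1, k\<^sub>2). k\<^sub>1 + k\<^sub>2 = k}"
    then obtain a b where "x = (a, b)" "k = a + b" by auto
    moreover have "of_nat c * word_poly w = Poly_Mapping.single (Word w) (of_nat c)"
      for c and w :: "('v \<times> nat) list"
      using scalar_times_single[of "of_nat c" "Word w" 1] by simp
    ultimately show "Poly_Mapping.single (Word [(i, k - snd x), (j, snd x)]) (of_nat (snd x choose p))
        = (case x of (k\<^sub>1, k\<^sub>2) \<Rightarrow>
            of_nat (k\<^sub>2 choose p) * (generator (i, k\<^sub>1) * generator (j, k\<^sub>2)))"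
      by (simp add: generator_mult)
  qed auto
  then show ?thesis
    unfolding arrow_relations_def by simp
qed

lemma relations_carrier:
  "commutation_relations Q \<union> arrow_relations Q \<subseteq> carrier (quiver_free_algebra Q)"
  unfolding commutation_relations_eq arrow_relations_eq
  by (auto intro!: diff_carrier sum_carrier single_carrier)

sublocale free: ring "quiver_free_algebra Q"
  by (rule ring_free_algebra)

sublocale rel: ideal "quiver_ideal Q" "quiver_free_algebra Q"
  unfolding quiver_ideal_def by (rule free.genideal_ideal[OF relations_carrier])

lemma relation_in_ideal:
  assumes "f \<in> commutation_relations Q \<union> arrow_relations Q" "set u \<subseteq> gens" "set v \<subseteq> gens"
  shows "word_poly u * f * word_poly v \<in> quiver_ideal Q"
proof -
  have "f \<in> quiver_ideal Q"
    unfolding quiver_ideal_def using free.genideal_self[OF relations_carrier] assms(1) by blast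
  then have "word_poly u * f \<in> quiver_ideal Q"
    using rel.I_l_closed[of f "word_poly u"] assms(2) by simp
  then show ?thesis
    using rel.I_r_closed[of "word_poly u * f" "word_poly v"] assms(3) by simp
qed

text \<open>The ideal is the smallest one containing the relations, so it is enough that these lie
  in the annihilated ideal. The contexts in \<open>kills\<close> match the words in the definition
  of that ideal.\<close>

lemma functional_quiver_ideal:
  assumes "kills \<phi>" "f \<in> quiver_ideal Q"
  shows "functional \<phi> f = 0"
proof -
  have "functional \<phi> (word_poly u * r * word_poly v) = 0"
    if "r \<in> commutation_relations Q \<union> arrow_relations Q" for r u v
    using that
  proof
    assume "r \<in> commutation_relations Q"
    then obtain i j a b where r: "r = word_poly [(i, a), (j, b)]
        - Poly_Mapping.single (Word [(j, b), (i, a)]) ((-1) ^ (m i i * m j j))"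
      unfolding commutation_relations_eq by blast
    have "functional \<phi> (word_poly u * r * word_poly v)
        = \<phi> (u @ (i, a) # (j, b) # v) - (-1) ^ (m i i * m j j) * \<phi> (u @ (j, b) # (i, a) # v)"
      unfolding r by (simp add: right_diff_distrib left_diff_distrib word_poly_sandwich functional_diff)
    also have "\<dots> = 0"
      using kills_swap[OF assms(1), of u i a j b v] by (simp add: mult.commute)
    finally show ?thesis .
  next
    assume "r \<in> arrow_relations Q"
    then obtain i j k p where r: "r = (\<Sum>l\<le>k. Poly_Mapping.single (Word [(i, k - l), (j, l)]) (of_nat (l choose p)))"
      and p: "p < m i j"
      unfolding arrow_relations_eq by blast
    have "functional \<phi> (word_poly u * r * word_poly v)
        = (\<Sum>l\<le>k. of_nat (l choose p) * \<phi> (u @ (i, k - l) # (j, l) # v))"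
      unfolding r by (simp add: sum_distrib_left sum_distrib_right word_poly_sandwich functional_sum)
    then show ?thesis
      using kills_arrow[OF assms(1) p] by simp
  qed
  then have "commutation_relations Q \<union> arrow_relations Q \<subseteq> annihilated gens \<phi>"
    using relations_carrier unfolding annihilated_def by blast
  then have "quiver_ideal Q \<subseteq> annihilated gens \<phi>"
    unfolding quiver_ideal_def by (rule free.genideal_minimal[OF ideal_annihilated])
  then have "functional \<phi> (word_poly [] * f * word_poly []) = 0"
    using assms(2) unfolding annihilated_def by blast
  moreover have "word_poly [] = (1 :: ('v \<times> nat) noncomm_poly)"
    by (metis single_one zero_free_monoid_def)
  ultimately show ?thesis by simp
qed

text \<open>All words in one relation share their context and their two vertices. A relation thus
  lies entirely inside or entirely outside the words over the quiver, and extension by zero respects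
  it.\<close>

lemma kills_restrict:
  fixes \<psi> :: "('v \<times> nat) noncomm_poly \<Rightarrow> rat"
  assumes add: "\<And>f g. \<psi> (f + g) = \<psi> f + \<psi> g" and scale: "\<And>c f. \<psi> (scalar c * f) = c * \<psi> f"
    and ideal: "\<And>f. f \<in> quiver_ideal Q \<Longrightarrow> \<psi> f = 0"
  shows "kills (\<lambda>w. if set w \<subseteq> gens then \<psi> (word_poly w) else 0)"
proof -
  have single: "\<psi> (Poly_Mapping.single w c) = c * \<psi> (Poly_Mapping.single w 1)" for w c
    using scale[of c "Poly_Mapping.single w 1"] by (simp add: scalar_times_single)
  have diff: "\<psi> (f - g) = \<psi> f - \<psi> g" for f g
    using add[of "f - g" g] by simp
  have zero: "\<psi> 0 = 0"
    using add[of 0 0] by simp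
  have sum: "\<psi> (sum F A) = (\<Sum>i\<in>A. \<psi> (F i))" for F :: "nat \<Rightarrow> ('v \<times> nat) noncomm_poly" and A
    by (induction A rule: infinite_finite_induct) (simp_all add: add zero)
  have mem: "set (u @ (i, a) # (j, b) # v) \<subseteq> gens
      \<longleftrightarrow> set u \<subseteq> gens \<and> set v \<subseteq> gens \<and> i \<in> verts Q \<and> j \<in> verts Q" for u v i j a b
    by auto
  show ?thesis
    unfolding kills_def
  proof (intro conjI allI impI)
    fix u v :: "('v \<times> nat) list" and i j a b
    let ?e = "(-1) ^ (m i i * m j j) :: rat"
    show "(if set (u @ (j, b) # (i, a) # v) \<subseteq> gens then \<psi> (word_poly (u @ (j, b) # (i, a) # v)) else 0)
        = ?e * (if set (u @ (i, a) # (j, b) # v) \<subseteq> gens then \<psi> (word_poly (u @ (i, a) # (j, b) # v)) else 0)"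
    proof (cases "set u \<subseteq> gens \<and> set v \<subseteq> gens \<and> i \<in> verts Q \<and> j \<in> verts Q")
      case True
      let ?r = "word_poly [(i, a), (j, b)] - Poly_Mapping.single (Word [(j, b), (i, a)]) ?e"
      have "?r \<in> commutation_relations Q"
        using True unfolding commutation_relations_eq by blast
      then have "\<psi> (word_poly u * ?r * word_poly v) = 0"
        using True by (intro ideal relation_in_ideal) auto
      then have "\<psi> (word_poly (u @ (i, a) # (j, b) # v)) = ?e * \<psi> (word_poly (u @ (j, b) # (i, a) # v))"
        using single[of "Word (u @ (j, b) # (i, a) # v)" ?e]
        by (simp add: right_diff_distrib left_diff_distrib word_poly_sandwich diff)
      then have "?e * \<psi> (word_poly (u @ (i, a) # (j, b) # v)) = \<psi> (word_poly (u @ (j, b) # (i, a) # v))"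
        by (cases "even (m i i * m j j)") simp_all
      then show ?thesis
        using True by (simp only: mem) simp
    next
      case False
      then show ?thesis by (simp only: mem) auto
    qed
  next
    fix u v :: "('v \<times> nat) list" and i j k p assume p: "p < m i j"
    show "(\<Sum>l\<le>k. of_nat (l choose p) * (if set (u @ (i, k - l) # (j, l) # v) \<subseteq> gens
        then \<psi> (word_poly (u @ (i, k - l) # (j, l) # v)) else 0)) = 0"
    proof (cases "set u \<subseteq> gens \<and> set v \<subseteq> gens \<and> i \<in> verts Q \<and> j \<in> verts Q")
      case True
      let ?r = "\<Sum>l\<le>k. Poly_Mapping.single (Word [(i, k - l), (j, l)]) (of_nat (l choose p)) :: ('v \<times> nat) noncomm_poly"
      have "?r \<in> arrow_relations Q"
        using True p unfolding arrow_relations_eq by blast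
      then have "\<psi> (word_poly u * ?r * word_poly v) = 0"
        using True by (intro ideal relation_in_ideal) auto
      moreover have "\<psi> (word_poly u * ?r * word_poly v)
          = (\<Sum>l\<le>k. of_nat (l choose p) * \<psi> (word_poly (u @ (i, k - l) # (j, l) # v)))"
        unfolding sum_distrib_left sum_distrib_right word_poly_sandwich sum
        by (subst single) simp
      ultimately show ?thesis
        using True by (simp only: mem) simp
    next
      case False
      then show ?thesis by (simp only: mem) auto
    qed
  qed
qed

subsection \<open>A basis of each component\<close>

text \<open>A single shape \<open>vs\<close> serves for each weight, since the commutation relations
  rearrange any word to it up to a sign.\<close>

definition normal_msets :: "'v list \<Rightarrow> int \<Rightarrow> ('v \<times> nat) multiset set" where
  "normal_msets vs k =
     {M. image_mset fst M = mset vs \<and> word_degree Q (Word (normal_word vs M)) = k}"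

definition component_words :: "'v list \<Rightarrow> int \<Rightarrow> ('v \<times> nat) list set" where
  "component_words vs k =
     {w. set w \<subseteq> gens \<and> mset (map fst w) = mset vs \<and> word_degree Q (Word w) = k}"

lemma word_degree_eq:
  "word_degree Q (Word w)
    = - (2 * int (sum_list (map snd w)) + int (sum_list (map (\<lambda>i. m i i) (map fst w))))"
  unfolding word_degree_def by (induction w) auto

lemma word_degree_eq_iff:
  assumes "mset (map fst w) = mset (map fst w')"
  shows "word_degree Q (Word w) = word_degree Q (Word w') \<longleftrightarrow> sum_list (map snd w) = sum_list (map snd w')"
  using sum_list_mset_cong[OF assms, of "\<lambda>i. m i i"] by (simp add: word_degree_eq)

lemma word_degree_normal_word:
  assumes "image_mset fst M = mset vs"
  shows "word_degree Q (Word (normal_word vs M))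
    = - int (2 * \<Sum>\<^sub># (image_mset snd M) + 2 * degree_below (length vs) (divisor_exp vs)
        + sum_list (map (\<lambda>i. m i i) vs))"
  unfolding word_degree_eq map_fst_normal_word sum_normal_word[OF assms] by simp

lemma finite_normal_msets: "finite (normal_msets vs k)"
proof (rule finite_subset)
  show "normal_msets vs k \<subseteq> (\<Union>N\<in>{..nat (- k)}. labellings (mset vs) N)"
  proof
    fix M assume M: "M \<in> normal_msets vs k"
    then have "- k = int (2 * \<Sum>\<^sub># (image_mset snd M)
        + 2 * degree_below (length vs) (divisor_exp vs) + sum_list (map (\<lambda>i. m i i) vs))"
      using word_degree_normal_word[of M vs] by (auto simp: normal_msets_def)
    then have "\<Sum>\<^sub># (image_mset snd M) \<in> {..nat (- k)}"
      unfolding atMost_iff by linarith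
    with M show "M \<in> (\<Union>N\<in>{..nat (- k)}. labellings (mset vs) N)"
      by (auto simp: normal_msets_def labellings_def)
  qed
qed (simp add: finite_labellings)

definition normal_comb :: "'v list \<Rightarrow> (('v \<times> nat) multiset \<Rightarrow> rat) \<Rightarrow> ('v \<times> nat) multiset set
    \<Rightarrow> ('v \<times> nat) noncomm_poly" where
  "normal_comb vs g S = (\<Sum>M\<in>S. Poly_Mapping.single (Word (normal_word vs M)) (g M))"

lemma normal_comb_add:
  "normal_comb vs g S + normal_comb vs h S = normal_comb vs (\<lambda>M. g M + h M) S"
  by (simp add: normal_comb_def single_add sum.distrib)

lemma scalar_times_normal_comb: "scalar c * normal_comb vs g S = normal_comb vs (\<lambda>M. c * g M) S"
  by (simp add: normal_comb_def sum_distrib_left scalar_times_single)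

lemma set_normal_word: "set vs \<subseteq> verts Q \<Longrightarrow> set (normal_word vs M) \<subseteq> gens"
proof -
  assume vs: "set vs \<subseteq> verts Q"
  have "fst ` set (normal_word vs M) = set vs"
    by (metis list.set_map map_fst_normal_word)
  with vs have "fst ` set (normal_word vs M) \<subseteq> verts Q" by simp
  then show ?thesis by force
qed

lemma normal_comb_carrier:
  "set vs \<subseteq> verts Q \<Longrightarrow> normal_comb vs g S \<in> carrier (quiver_free_algebra Q)"
  unfolding normal_comb_def by (intro sum_carrier single_carrier set_normal_word)

text \<open>\<open>T\<close> is the ideal plus the span of the normal words. A component word
  outside \<open>T\<close> would be detected by a functional vanishing on \<open>T\<close>; but such
  a functional, nonzero at that word, is nonzero at a normal word of the same degree.\<close>

lemma normal_words_span:
  assumes f: "\<And>w. w \<in> keys f \<Longrightarrow> letters w \<in> component_words vs k"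
  shows "\<exists>g. f - normal_comb vs g (normal_msets vs k) \<in> quiver_ideal Q"
proof -
  let ?S = "normal_msets vs k"
  define T where "T = {f. \<exists>g. f - normal_comb vs g ?S \<in> quiver_ideal Q}"
  have "0 \<in> T"
    using rel.zero_closed unfolding T_def normal_comb_def by (auto intro: exI[of _ "\<lambda>_. 0"])
  have T_add: "x + y \<in> T" if xy: "x \<in> T" "y \<in> T" for x y
  proof -
    obtain g h where "x - normal_comb vs g ?S \<in> quiver_ideal Q" "y - normal_comb vs h ?S \<in> quiver_ideal Q"
      using xy by (auto simp: T_def)
    from rel.a_closed[OF this] have "(x + y) - normal_comb vs (\<lambda>M. g M + h M) ?S \<in> quiver_ideal Q"
      by (simp add: normal_comb_add[symmetric] algebra_simps)
    then show ?thesis unfolding T_def by blast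
  qed
  have T_scale: "scalar c * x \<in> T" if x: "x \<in> T" for c x
  proof -
    obtain g where g: "x - normal_comb vs g ?S \<in> quiver_ideal Q"
      using x by (auto simp: T_def)
    have "scalar c * (x - normal_comb vs g ?S) \<in> quiver_ideal Q"
      using rel.I_l_closed[OF g scalar_carrier[of c]] by simp
    then have "scalar c * x - normal_comb vs (\<lambda>M. c * g M) ?S \<in> quiver_ideal Q"
      by (simp add: right_diff_distrib scalar_times_normal_comb)
    then show ?thesis unfolding T_def by blast
  qed
  have normal_T: "word_poly (normal_word vs M) \<in> T" if "M \<in> ?S" for M
  proof -
    have "normal_comb vs (\<lambda>N. if N = M then 1 else 0) ?S = word_poly (normal_word vs M)"
      unfolding normal_comb_def using that
      by (subst sum.remove[OF finite_normal_msets]) auto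
    then show ?thesis
      using rel.zero_closed unfolding T_def by (auto intro!: exI[of _ "\<lambda>N. if N = M then 1 else 0"])
  qed
  have ideal_T: "x \<in> T" if "x \<in> quiver_ideal Q" for x
    using that unfolding T_def by (auto intro!: exI[of _ "\<lambda>_. 0"] simp: normal_comb_def)
  have word_T: "word_poly w \<in> T" if w: "w \<in> component_words vs k" for w
  proof (rule ccontr)
    assume w_notin: "word_poly w \<notin> T"
    have "\<exists>\<psi> :: ('v \<times> nat) noncomm_poly \<Rightarrow> rat. (\<forall>f g. \<psi> (f + g) = \<psi> f + \<psi> g)
        \<and> (\<forall>c f. \<psi> (scalar c * f) = c * \<psi> f) \<and> (\<forall>f\<in>T. \<psi> f = 0) \<and> \<psi> (word_poly w) = 1"
      using \<open>0 \<in> T\<close> T_add T_scale w_notin by (rule exists_separating_functional)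
    then obtain \<psi> :: "('v \<times> nat) noncomm_poly \<Rightarrow> rat"
      where \<psi>: "\<forall>f g. \<psi> (f + g) = \<psi> f + \<psi> g" "\<forall>c f. \<psi> (scalar c * f) = c * \<psi> f"
      "\<forall>f\<in>T. \<psi> f = 0" "\<psi> (word_poly w) = 1"
      by blast
    let ?\<phi> = "\<lambda>w. if set w \<subseteq> gens then \<psi> (word_poly w) else 0"
    have "kills ?\<phi>"
      using \<psi> ideal_T by (intro kills_restrict) auto
    moreover have "?\<phi> w \<noteq> 0" "mset (map fst w) = mset vs"
      using w \<psi>(4) by (auto simp: component_words_def)
    ultimately obtain M where M: "image_mset fst M = mset vs"
      "sum_list (map snd (normal_word vs M)) = sum_list (map snd w)" "?\<phi> (normal_word vs M) \<noteq> 0"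
      using kills_nonzero_normal_word[of ?\<phi> w vs] by blast
    have "word_degree Q (Word (normal_word vs M)) = word_degree Q (Word w)"
      using M(2) \<open>mset (map fst w) = mset vs\<close> by (subst word_degree_eq_iff) simp_all
    then have "M \<in> ?S"
      using M(1) w by (simp add: normal_msets_def component_words_def)
    then show False
      using \<psi>(3) normal_T[of M] M(3) by (simp split: if_splits)
  qed
  have "(\<Sum>w\<in>A. Poly_Mapping.single w (lookup f w)) \<in> T" if "A \<subseteq> keys f" for A
    using finite_subset[OF that finite_keys] that
  proof (induction A)
    case (insert w A)
    have "word_poly (letters w) \<in> T"
      using f insert.prems by (intro word_T) simp
    from T_scale[OF this, of "lookup f w"] have "Poly_Mapping.single w (lookup f w) \<in> T"
      by (simp add: scalar_times_single)
    with insert show ?case by (simp add: T_add)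
  qed (simp add: \<open>0 \<in> T\<close>)
  from this[of "keys f"] have "f \<in> T"
    by (simp add: sum_single_lookup)
  then show ?thesis by (simp add: T_def)
qed

text \<open>The dual functionals are triangular with respect to the order of the exponents.\<close>

lemma normal_words_independent:
  assumes "finite S" and S: "\<And>M. M \<in> S \<Longrightarrow> image_mset fst M = mset vs"
    and "normal_comb vs g S \<in> quiver_ideal Q" and "M \<in> S"
  shows "g M = 0"
proof (rule ccontr)
  assume "g M \<noteq> 0"
  define B where "B = {M \<in> S. g M \<noteq> 0}"
  have "finite B" "B \<noteq> {}"
    using assms \<open>g M \<noteq> 0\<close> by (auto simp: B_def)
  \<comment> \<open>\<open>dual_functional N\<close> detects only normal words whose orbit maximum
    is at most that of \<open>N\<close>. By minimality no term with nonzero coefficient other than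
    the one at \<open>N\<close> remains.\<close>
  define N where "N = arg_min_on (\<lambda>M. Max (orbit vs M)) B"
  have N: "N \<in> S" "g N \<noteq> 0"
    using arg_min_if_finite(1)[OF \<open>finite B\<close> \<open>B \<noteq> {}\<close>, of "\<lambda>M. Max (orbit vs M)"]
    by (auto simp: N_def B_def)
  have N_min: "Max (orbit vs N) \<le> Max (orbit vs K)" if "K \<in> B" for K
    unfolding N_def using \<open>finite B\<close> that by (intro arg_min_least) auto
  have "g K * dual_functional N (normal_word vs K) = 0" if "K \<in> S - {N}" for K
  proof (rule ccontr)
    assume *: "g K * dual_functional N (normal_word vs K) \<noteq> 0"
    then have "Max (orbit vs K) \<le> Max (orbit vs N)"
      using that N(1) S by (intro dual_functional_normal_word(2)) auto
    moreover have "Max (orbit vs N) \<le> Max (orbit vs K)"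
      using * that by (intro N_min) (simp add: B_def)
    ultimately have "K = N"
      using that N(1) S by (intro Max_orbit_inject[of K vs N]) auto
    with that show False by simp
  qed
  then have "(\<Sum>K\<in>S - {N}. g K * dual_functional N (normal_word vs K)) = 0"
    by (intro sum.neutral) blast
  then have "functional (dual_functional N) (normal_comb vs g S) = g N * dual_functional N (normal_word vs N)"
    unfolding normal_comb_def functional_sum
    by (subst sum.remove[OF assms(1) N(1)]) simp
  moreover have "functional (dual_functional N) (normal_comb vs g S) = 0"
    using kills_dual_functional assms(3) by (rule functional_quiver_ideal)
  ultimately show False
    using dual_functional_normal_word(1)[of N vs N] S[OF N(1)] N(2) by simp
qed

text \<open>The empty word is normal, hence independent modulo the ideal. The algebra is therefore
  nonzero, and its scalars form a field.\<close>

lemma one_notin_ideal: "1 \<notin> quiver_ideal Q"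
proof
  assume "1 \<in> quiver_ideal Q"
  moreover have "normal_comb [] (\<lambda>_. 1) {{#}} = 1"
  proof -
    have "normal_word [] {#} = []"
      by (metis length_0_conv length_mk_word list.size(3) normal_word_def)
    then show ?thesis
      by (simp add: normal_comb_def flip: zero_free_monoid_def)
  qed
  ultimately show False
    using normal_words_independent[of "{{#}}" "[]" "\<lambda>_. 1" "{#}"] by simp
qed


subsection \<open>Dimensions\<close>

sublocale quot: ring "quiver_algebra Q"
  unfolding quiver_algebra_def by (rule rel.quotient_is_ring)

sublocale proj: ring_hom_ring "quiver_free_algebra Q" "quiver_algebra Q" "quiver_proj Q"
  unfolding quiver_algebra_def quiver_proj_def[abs_def] by (rule rel.rcos_ring_hom_ring)

lemma quiver_proj_eq_iff:
  assumes "f \<in> carrier (quiver_free_algebra Q)" "g \<in> carrier (quiver_free_algebra Q)"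
  shows "quiver_proj Q f = quiver_proj Q g \<longleftrightarrow> f - g \<in> quiver_ideal Q"
  using free.quotient_eq_iff_same_a_r_cos[OF rel.ideal_axioms assms]
  by (simp add: quiver_proj_def minus_free_algebra[OF assms])

lemma subfield_scalars: "subfield (range scalar) (quiver_free_algebra Q)"
proof (rule free.subfieldI)
  show "subcring (range scalar) (quiver_free_algebra Q)"
  proof (rule free.subcringI)
    show "subring (range scalar) (quiver_free_algebra Q)"
    proof (rule free.subringI)
      show "range scalar \<subseteq> carrier (quiver_free_algebra Q)"
        by auto
      show "\<one>\<^bsub>quiver_free_algebra Q\<^esub> \<in> range scalar"
        by (rule range_eqI[of _ _ 1]) simp
      show "\<ominus>\<^bsub>quiver_free_algebra Q\<^esub> h \<in> range scalar" if "h \<in> range scalar" for h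
        using that by (auto simp: uminus_free_algebra simp flip: single_uminus)
      show "h1 \<otimes>\<^bsub>quiver_free_algebra Q\<^esub> h2 \<in> range scalar"
        if "h1 \<in> range scalar" "h2 \<in> range scalar" for h1 h2
        using that by (auto simp: mult_single)
      show "h1 \<oplus>\<^bsub>quiver_free_algebra Q\<^esub> h2 \<in> range scalar"
        if "h1 \<in> range scalar" "h2 \<in> range scalar" for h1 h2
        using that by (auto simp flip: single_add)
    qed
  qed (auto simp: mult_single mult.commute)
  show "Units (quiver_free_algebra Q\<lparr>carrier := range scalar\<rparr>)
      = range scalar - {\<zero>\<^bsub>quiver_free_algebra Q\<^esub>}"
  proof (intro Set.set_eqI iffI)
    fix x assume "x \<in> Units (quiver_free_algebra Q\<lparr>carrier := range scalar\<rparr>)"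
    then obtain y where "x \<in> range scalar" "y * x = 1"
      by (auto simp: Units_def)
    then show "x \<in> range scalar - {\<zero>\<^bsub>quiver_free_algebra Q\<^esub>}"
      by auto
  next
    fix x :: "('v \<times> nat) noncomm_poly"
    assume "x \<in> range scalar - {\<zero>\<^bsub>quiver_free_algebra Q\<^esub>}"
    then obtain c where c: "x = scalar c" "c \<noteq> 0" by auto
    then have "scalar (inverse c) * x = 1" "x * scalar (inverse c) = 1"
      by (simp_all add: mult_single)
    with c show "x \<in> Units (quiver_free_algebra Q\<lparr>carrier := range scalar\<rparr>)"
      unfolding Units_def by auto
  qed
qed

lemma subfield_quiver_scalars: "subfield (quiver_scalars Q) (quiver_algebra Q)"
proof -
  have "\<one>\<^bsub>quiver_algebra Q\<^esub> \<noteq> \<zero>\<^bsub>quiver_algebra Q\<^esub>"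
    using quiver_proj_eq_iff[OF _ zero_carrier, of 1] free.one_closed one_notin_ideal
      proj.hom_one proj.hom_zero
    by simp
  then have "subfield (quiver_proj Q ` range scalar) (quiver_algebra Q)"
    by (rule proj.img_is_subfield(2)[OF subfield_scalars])
  then show ?thesis
    by (simp add: quiver_scalars_def image_image)
qed

section \<open>Span and independence of the cosets of normal words\<close>

abbreviation "normal_coset vs M \<equiv> quiver_proj Q (word_poly (normal_word vs M))"

lemma combine_normal_cosets:
  assumes vs: "set vs \<subseteq> verts Q" and "distinct Ms"
  shows "quot.combine (map (\<lambda>M. quiver_proj Q (scalar (g M))) Ms) (map (normal_coset vs) Ms)
    = quiver_proj Q (normal_comb vs g (set Ms))"
  using assms(2)
proof (induction Ms)
  case Nil
  show ?case
    using proj.hom_zero by (simp add: normal_comb_def)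
next
  case (Cons M Ms)
  let ?w = "normal_word vs M"
  have "quiver_proj Q (scalar (g M)) \<otimes>\<^bsub>quiver_algebra Q\<^esub> normal_coset vs M
      = quiver_proj Q (Poly_Mapping.single (Word ?w) (g M))"
    using proj.hom_mult[of "scalar (g M)" "word_poly ?w"] set_normal_word[OF vs]
    by (simp add: scalar_times_single)
  moreover have "quiver_proj Q (Poly_Mapping.single (Word ?w) (g M))
      \<oplus>\<^bsub>quiver_algebra Q\<^esub> quiver_proj Q (normal_comb vs g (set Ms))
      = quiver_proj Q (Poly_Mapping.single (Word ?w) (g M) + normal_comb vs g (set Ms))"
    using proj.hom_add[OF single_carrier[OF set_normal_word[OF vs]] normal_comb_carrier[OF vs]]
    by simp
  ultimately show ?case
    using Cons by (simp add: normal_comb_def)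
qed

lemma normal_coset_carrier: "set vs \<subseteq> verts Q \<Longrightarrow> normal_coset vs M \<in> carrier (quiver_algebra Q)"
  by (intro proj.hom_closed) (simp add: set_normal_word)

lemma Span_normal_cosets:
  assumes vs: "set vs \<subseteq> verts Q" and "distinct Ms"
  shows "quot.Span (quiver_scalars Q) (map (normal_coset vs) Ms)
    = {quiver_proj Q (normal_comb vs g (set Ms)) | g. True}"
proof (intro Set.set_eqI iffI)
  fix x
  note span = quot.Span_mem_iff_length_version[OF subfield_quiver_scalars, of "map (normal_coset vs) Ms"]
  have carr: "set (map (normal_coset vs) Ms) \<subseteq> carrier (quiver_algebra Q)"
    using normal_coset_carrier[OF vs] by auto
  {
    assume "x \<in> quot.Span (quiver_scalars Q) (map (normal_coset vs) Ms)"
    then obtain Ks where Ks: "set Ks \<subseteq> quiver_scalars Q" "length Ks = length Ms"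
      "x = quot.combine Ks (map (normal_coset vs) Ms)"
      unfolding span[OF carr] by auto
    from Ks(1) have "\<forall>K\<in>set Ks. \<exists>c. K = quiver_proj Q (scalar c)"
      by (auto simp: quiver_scalars_def)
    then obtain cs where "Ks = map (\<lambda>c. quiver_proj Q (scalar c)) cs"
      unfolding ex_map_conv[symmetric] ..
    moreover from this Ks(2) obtain g where "map g Ms = cs"
      using ex_map_eq[OF assms(2), of cs] by auto
    ultimately have "Ks = map (\<lambda>M. quiver_proj Q (scalar (g M))) Ms"
      by auto
    then show "x \<in> {quiver_proj Q (normal_comb vs g (set Ms)) | g. True}"
      using Ks(3) combine_normal_cosets[OF assms] by blast
  next
    assume "x \<in> {quiver_proj Q (normal_comb vs g (set Ms)) | g. True}"
    then obtain g where "x = quot.combine (map (\<lambda>M. quiver_proj Q (scalar (g M))) Ms) (map (normal_coset vs) Ms)"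
      using combine_normal_cosets[OF assms] by auto
    then show "x \<in> quot.Span (quiver_scalars Q) (map (normal_coset vs) Ms)"
      unfolding span[OF carr]
      by (intro exI[of _ "map (\<lambda>M. quiver_proj Q (scalar (g M))) Ms"]) (auto simp: quiver_scalars_def)
  }
qed

lemma independent_normal_cosets:
  assumes vs: "set vs \<subseteq> verts Q" and "distinct Ms"
    and "\<And>M. M \<in> set Ms \<Longrightarrow> image_mset fst M = mset vs"
  shows "quot.independent (quiver_scalars Q) (map (normal_coset vs) Ms)"
  using assms(2,3)
proof (induction Ms)
  case (Cons M Ms)
  have "normal_coset vs M \<notin> quot.Span (quiver_scalars Q) (map (normal_coset vs) Ms)"
  proof
    assume "normal_coset vs M \<in> quot.Span (quiver_scalars Q) (map (normal_coset vs) Ms)"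
    then obtain g where "normal_coset vs M = quiver_proj Q (normal_comb vs g (set Ms))"
      using Span_normal_cosets[OF vs, of Ms] Cons.prems(1) by auto
    then have "word_poly (normal_word vs M) - normal_comb vs g (set Ms) \<in> quiver_ideal Q"
      using quiver_proj_eq_iff normal_comb_carrier[OF vs] set_normal_word[OF vs] by simp
    \<comment> \<open>Membership in the span yields a relation among normal words with coefficient 1
      at \<open>M\<close>.\<close>
    moreover have "normal_comb vs (\<lambda>N. if N = M then 1 else - g N) (set (M # Ms))
        = word_poly (normal_word vs M) - normal_comb vs g (set Ms)"
    proof -
      have "(\<Sum>N\<in>set Ms. Poly_Mapping.single (Word (normal_word vs N)) (if N = M then 1 else - g N))
          = (\<Sum>N\<in>set Ms. - Poly_Mapping.single (Word (normal_word vs N)) (g N))"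
        using Cons.prems(1) by (intro sum.cong) (auto simp: single_uminus)
      then show ?thesis
        using Cons.prems(1) by (simp add: normal_comb_def sum_negf)
    qed
    ultimately have "(if M = M then 1 else - g M) = 0"
      using normal_words_independent[of "set (M # Ms)" vs "\<lambda>N. if N = M then 1 else - g N" M]
        Cons.prems(2) by simp
    then show False by simp
  qed
  then show ?case
    using Cons normal_coset_carrier[OF vs] by (auto intro: quot.li_Cons)
qed simp

text \<open>Here \<open>vs\<close> is any listing of the vertices with multiplicities
  \<open>d\<close>. Reduction modulo the ideal gives one inclusion; the other holds because normal
  words of shape \<open>vs\<close> have the prescribed weight and degree.\<close>

lemma quiver_component_eq:
  assumes vs: "set vs \<subseteq> verts Q" and d: "\<And>i. count (mset vs) i = lookup d i"
  shows "quiver_component Q (exponent_weight d) k =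
    {quiver_proj Q (normal_comb vs g (normal_msets vs k)) | g. True}"
proof -
  have weight: "lookup (word_weight w) i = int (count (mset (map fst (letters w))) i)"
    for w :: "('v \<times> nat) free_monoid" and i
  proof -
    have "lookup (\<Sum>(i, k)\<leftarrow>l. Poly_Mapping.single i 1) i = int (count (mset (map fst l)) i)"
      for l :: "('v \<times> nat) list"
      by (induction l) (auto simp: lookup_add lookup_single when_def)
    then show ?thesis by (simp add: word_weight_def)
  qed
  have weight_iff: "word_weight w = exponent_weight d \<longleftrightarrow> mset (map fst (letters w)) = mset vs"
    for w :: "('v \<times> nat) free_monoid"
    by (simp only: poly_mapping_eq_iff fun_eq_iff weight lookup_exponent_weight multiset_eq_iff d of_nat_eq_iff)
  have words: "(f \<in> carrier (quiver_free_algebra Q)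
      \<and> (\<forall>w\<in>keys f. word_weight w = exponent_weight d \<and> word_degree Q w = k))
    \<longleftrightarrow> (\<forall>w\<in>keys f. letters w \<in> component_words vs k)" for f :: "('v \<times> nat) noncomm_poly"
    unfolding carrier_free_algebra component_words_def weight_iff by auto
  have comb: "letters w \<in> component_words vs k" if "w \<in> keys (normal_comb vs g (normal_msets vs k))" for w g
  proof -
    have "lookup (normal_comb vs g (normal_msets vs k)) w \<noteq> 0"
      using that by (simp add: in_keys_iff)
    then obtain M where "M \<in> normal_msets vs k"
      "lookup (Poly_Mapping.single (Word (normal_word vs M)) (g M)) w \<noteq> 0"
      unfolding normal_comb_def lookup_sum by (rule sum.not_neutral_contains_not_neutral)
    then have "M \<in> normal_msets vs k" "w = Word (normal_word vs M)"
      by (auto simp: lookup_single when_def split: if_splits)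
    then show ?thesis
      using set_normal_word[OF vs, of M]
      by (simp add: component_words_def normal_msets_def del: mset_map)
  qed
  show ?thesis
  proof (intro Set.set_eqI iffI)
    fix x assume "x \<in> quiver_component Q (exponent_weight d) k"
    then obtain f where f: "f \<in> carrier (quiver_free_algebra Q)" "x = quiver_proj Q f"
      "\<forall>w\<in>keys f. letters w \<in> component_words vs k"
      unfolding quiver_component_def using words by auto
    then obtain g where "f - normal_comb vs g (normal_msets vs k) \<in> quiver_ideal Q"
      using normal_words_span[of f vs k] by blast
    then have "x = quiver_proj Q (normal_comb vs g (normal_msets vs k))"
      using f quiver_proj_eq_iff[OF f(1) normal_comb_carrier[OF vs]] by simp
    then show "x \<in> {quiver_proj Q (normal_comb vs g (normal_msets vs k)) | g. True}"
      by blast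
  next
    fix x assume "x \<in> {quiver_proj Q (normal_comb vs g (normal_msets vs k)) | g. True}"
    then obtain g where x: "x = quiver_proj Q (normal_comb vs g (normal_msets vs k))"
      by blast
    show "x \<in> quiver_component Q (exponent_weight d) k"
      unfolding quiver_component_def x mem_Collect_eq words[symmetric]
      by (rule imageI) (use comb words in blast)
  qed
qed

lemma dimension_quiver_component:
  assumes vs: "set vs \<subseteq> verts Q" and d: "\<And>i. count (mset vs) i = lookup d i"
  shows "quot.dimension (card (normal_msets vs k)) (quiver_scalars Q)
    (quiver_component Q (exponent_weight d) k)"
proof -
  obtain Ms where Ms: "set Ms = normal_msets vs k" "distinct Ms"
    using finite_distinct_list[OF finite_normal_msets] by blast
  have "quot.independent (quiver_scalars Q) (map (normal_coset vs) Ms)"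
    using Ms by (intro independent_normal_cosets[OF vs]) (auto simp: normal_msets_def)
  then have "quot.dimension (length (map (normal_coset vs) Ms)) (quiver_scalars Q)
      (quiver_component Q (exponent_weight d) k)"
    unfolding quiver_component_eq[OF vs d] Ms(1)[symmetric] Span_normal_cosets[OF vs Ms(2), symmetric]
    by (rule quot.dimension_independent)
  then show ?thesis
    using distinct_card[OF Ms(2)] Ms(1) by simp
qed

text \<open>A sum over vertices weighted by \<open>d\<close> is a sum over the positions of
  \<open>vs\<close>. In the resulting double sum distinct positions give twice the degree of the
  divisor, and the diagonal gives the loops.\<close>

lemma arrow_form_eq:
  assumes vs: "set vs \<subseteq> verts Q" and d: "\<And>i. count (mset vs) i = lookup d i"
  shows "arrow_form Q d = 2 * degree_below (length vs) (divisor_exp vs) + sum_list (map (\<lambda>i. m i i) vs)"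
proof -
  have sum: "(\<Sum>i\<in>verts Q. lookup d i * h i) = (\<Sum>s<length vs. h (vs ! s))" for h :: "'v \<Rightarrow> nat"
  proof -
    have "(\<Sum>i\<in>verts Q. lookup d i * h i) = sum_list (map h vs)"
      using sum_list_map_eq_sum_count2[OF vs finite_verts, of h] by (simp add: d[symmetric] count_mset)
    also have "\<dots> = (\<Sum>s<length vs. h (vs ! s))"
      by (simp add: sum_list_sum_nth atLeast0LessThan)
    finally show ?thesis .
  qed
  have "arrow_form Q d = (\<Sum>i\<in>verts Q. lookup d i * (\<Sum>j\<in>verts Q. lookup d j * m i j))"
    by (simp add: arrow_form_def sum_distrib_left mult_ac)
  also have "\<dots> = (\<Sum>s<length vs. \<Sum>t<length vs. m (vs ! s) (vs ! t))"
    by (simp only: sum)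
  also have "\<dots> = 2 * (\<Sum>(s, t) | s < t \<and> t < length vs. m (vs ! s) (vs ! t))
      + (\<Sum>s<length vs. m (vs ! s) (vs ! s))"
    by (rule sum_square_symmetric) (rule num_arrows_commute)
  finally show ?thesis
    by (simp add: degree_divisor_exp sum_list_sum_nth atLeast0LessThan)
qed

text \<open>A normal word has degree \<open>- E - 2 N\<close>, where
  \<open>E = arrow_form Q d\<close> and \<open>N\<close> is the total label of its multiset. Only
  degrees of the parity of \<open>E\<close> occur, in agreement with the vanishing odd coefficients
  of \<open>labelling_series\<close>.\<close>

lemma card_normal_msets:
  assumes vs: "set vs \<subseteq> verts Q" and d: "\<And>i. count (mset vs) i = lookup d i"
  shows "of_nat (card (normal_msets vs k)) =
    (if - k < int (arrow_form Q d) then 0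
     else labelling_series (mset vs) $ nat (- k - int (arrow_form Q d)))"
proof -
  let ?E = "arrow_form Q d"
  have "word_degree Q (Word (normal_word vs M)) = k
      \<longleftrightarrow> - k = int ?E + 2 * int (\<Sum>\<^sub># (image_mset snd M))" if "image_mset fst M = mset vs" for M
    using word_degree_normal_word[OF that] arrow_form_eq[OF vs d] by auto
  then have normal: "normal_msets vs k
      = {M. image_mset fst M = mset vs \<and> - k = int ?E + 2 * int (\<Sum>\<^sub># (image_mset snd M))}"
    unfolding normal_msets_def by auto
  show ?thesis
  proof (cases "- k < int ?E")
    case True
    then have "- k \<noteq> int ?E + 2 * int x" for x by linarith
    then have "normal_msets vs k = {}"
      unfolding normal by blast
    then show ?thesis using True by simp
  next
    case False
    define n where "n = nat (- k - int ?E)"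
    have k: "- k = int ?E + int n"
      using False by (simp add: n_def)
    have "- k = int ?E + 2 * int x \<longleftrightarrow> even n \<and> x = n div 2" for x
      unfolding k by presburger
    then have "normal_msets vs k = (if even n then labellings (mset vs) (n div 2) else {})"
      unfolding normal labellings_def by (simp only:) auto
    then show ?thesis
      using False by (simp add: labelling_series_def flip: n_def)
  qed
qed

lemma quiver_component_trivial:
  assumes "\<And>w. set (letters w) \<subseteq> gens \<Longrightarrow> word_weight w \<noteq> d"
  shows "quiver_component Q d k = {\<zero>\<^bsub>quiver_algebra Q\<^esub>}"
proof -
  have "{f \<in> carrier (quiver_free_algebra Q). \<forall>w\<in>keys f. word_weight w = d \<and> word_degree Q w = k} = {0}"
  proof -
    have "f = 0" if "f \<in> carrier (quiver_free_algebra Q)"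
      "\<forall>w\<in>keys f. word_weight w = d \<and> word_degree Q w = k" for f :: "('v \<times> nat) noncomm_poly"
      using that assms by (intro poly_mapping_eqI) (auto simp: carrier_free_algebra in_keys_iff)
    then show ?thesis by (auto simp: carrier_free_algebra)
  qed
  then show ?thesis
    using proj.hom_zero by (simp add: quiver_component_def)
qed

end

theorem proposition3p6:
  fixes Q :: "('v, 'e) pre_digraph"
  assumes "fin_digraph Q"
    and "symmetric_quiver Q"
  shows "\<exists>P. is_poincare_series (quiver_algebra Q) (quiver_scalars Q) (quiver_component Q) P
    \<and> motivic_series Q = rescale_variables q_half P"
proof (intro exI conjI)
  interpret fin_digraph Q by (rule assms(1))
  interpret finite_symmetric_quiver Q
    by unfold_locales (rule assms(2))
  show "motivic_series Q = rescale_variables q_half (poincare_coeff Q)"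
    using finite_verts by (rule motivic_series_eq_rescale)
  have weight_word: "\<exists>e. word_weight w = exponent_weight e \<and> (set (letters w) \<subseteq> gens \<longrightarrow> keys e \<subseteq> verts Q)"
    for w :: "('v \<times> nat) free_monoid"
  proof -
    have "\<exists>e. (\<Sum>(i, k)\<leftarrow>l. Poly_Mapping.single i 1) = exponent_weight e \<and> keys e \<subseteq> fst ` set l"
      for l :: "('v \<times> nat) list"
    proof (induction l)
      case Nil
      have "(0 :: 'v \<Rightarrow>\<^sub>0 int) = exponent_weight 0"
        by (rule poly_mapping_eqI) (simp add: lookup_exponent_weight)
      then show ?case by (intro exI[of _ 0]) simp
    next
      case (Cons p l)
      then obtain e where e: "(\<Sum>(i, k)\<leftarrow>l. Poly_Mapping.single i 1) = exponent_weight e"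
        "keys e \<subseteq> fst ` set l" by blast
      have "Poly_Mapping.single (fst p) 1 + exponent_weight e
          = exponent_weight (Poly_Mapping.single (fst p) 1 + e)"
        by (rule poly_mapping_eqI) (simp add: lookup_exponent_weight lookup_add lookup_single when_def)
      then show ?case
        using e Poly_Mapping.keys_add[of "Poly_Mapping.single (fst p) 1" e]
        by (intro exI[of _ "Poly_Mapping.single (fst p) 1 + e"]) (auto simp: case_prod_unfold)
    qed
    from this[of "letters w"] show ?thesis
      unfolding word_weight_def by fastforce
  qed
  have exponent_weight_inject: "d = e" if "exponent_weight d = exponent_weight e" for d e :: "'v \<Rightarrow>\<^sub>0 nat"
    using that by (intro poly_mapping_eqI) (metis lookup_exponent_weight of_nat_eq_iff)
  \<comment> \<open>Words have nonnegative weights supported on vertices. This disposes both of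
    weights with negative entries and of exponents at elements that are not vertices.\<close>
  have outside: "quiver_component Q d k = {\<zero>\<^bsub>quiver_algebra Q\<^esub>}"
    if "d \<notin> exponent_weight ` {e. keys e \<subseteq> verts Q}" for d k
    using that weight_word by (intro quiver_component_trivial) (metis image_eqI mem_Collect_eq)
  have inside: "\<exists>vs. set vs \<subseteq> verts Q \<and> (\<forall>i. count (mset vs) i = lookup d i)"
    if "keys d \<subseteq> verts Q" for d :: "'v \<Rightarrow>\<^sub>0 nat"
  proof -
    obtain vs where vs: "mset vs = (\<Sum>i\<in>keys d. replicate_mset (lookup d i) i)"
      using ex_mset by blast
    have count: "count (mset vs) i = lookup d i" for i
      by (simp add: vs count_sum in_keys_iff if_distrib cong: if_cong)
    have "set vs \<subseteq> keys d"
      by (auto simp: in_keys_iff simp flip: count)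
    with that count show ?thesis by blast
  qed
  show "is_poincare_series (quiver_algebra Q) (quiver_scalars Q) (quiver_component Q) (poincare_coeff Q)"
    unfolding is_poincare_series_def
  proof (intro conjI allI impI)
    fix d k
    show "quot.finite_dimension (quiver_scalars Q) (quiver_component Q d k)"
    proof (cases "d \<in> exponent_weight ` {e. keys e \<subseteq> verts Q}")
      case True
      then obtain e vs where "d = exponent_weight e" "set vs \<subseteq> verts Q" "\<forall>i. count (mset vs) i = lookup e i"
        using inside by blast
      then show ?thesis
        using dimension_quiver_component[of vs e k] by (auto intro: quot.finite_dimensionI)
    next
      case False
      then show ?thesis
        by (auto simp: outside intro: quot.finite_dimensionI)
    qed
  next
    fix d k assume "d \<notin> range (exponent_weight :: ('v \<Rightarrow>\<^sub>0 nat) \<Rightarrow> _)"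
    then show "quiver_component Q d k = {\<zero>\<^bsub>quiver_algebra Q\<^esub>}"
      by (intro outside) auto
  next
    fix d :: "'v \<Rightarrow>\<^sub>0 nat" and k
    show "fls_nth (laurent_expansion (poincare_coeff Q d)) (- k)
        = (-1) powi (- k) * of_nat (quot.dim (quiver_scalars Q) (quiver_component Q (exponent_weight d) k))"
    proof (cases "keys d \<subseteq> verts Q")
      case True
      then obtain vs where vs: "set vs \<subseteq> verts Q" "\<And>i. count (mset vs) i = lookup d i"
        using inside by blast
      have dim: "quot.dim (quiver_scalars Q) (quiver_component Q (exponent_weight d) k) = card (normal_msets vs k)"
        using quot.dimI[OF subfield_quiver_scalars dimension_quiver_component[OF vs]] by (simp add: over_def)
      show ?thesis
      proof (cases "- k < int (arrow_form Q d) \<or> odd (nat (- k - int (arrow_form Q d)))")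
        \<comment> \<open>No normal word has such a degree, and the closed form has no term
          there.\<close>
        case True
        then show ?thesis
          unfolding dim card_normal_msets[OF vs]
            fls_nth_laurent_expansion_poincare_coeff[OF finite_verts \<open>keys d \<subseteq> verts Q\<close> vs(2)]
          by (auto simp: labelling_series_def)
      next
        case False
        then obtain j where "nat (- k - int (arrow_form Q d)) = 2 * j"
          by blast
        with False have k: "- k = int (arrow_form Q d + 2 * j)"
          by auto
        \<comment> \<open>The sign in the Poincare series depends on \<open>k\<close> and that of
          the closed form on the arrow form; they agree because \<open>- k\<close> has the parity of
          the arrow form.\<close>
        have "(-1) powi (- k) = ((-1) ^ arrow_form Q d :: rat)"
          unfolding k power_int_of_nat by (simp add: power_add power_mult)
        with False show ?thesis
          unfolding dim card_normal_msets[OF vs]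
            fls_nth_laurent_expansion_poincare_coeff[OF finite_verts \<open>keys d \<subseteq> verts Q\<close> vs(2)]
          by simp
      qed
    next
      case False
      then have "exponent_weight d \<notin> exponent_weight ` {e. keys e \<subseteq> verts Q}"
        using exponent_weight_inject by blast
      then have "quot.dim (quiver_scalars Q) (quiver_component Q (exponent_weight d) k) = 0"
        using quot.dimI[OF subfield_quiver_scalars quot.zero_dim] by (simp add: outside over_def)
      moreover have "laurent_expansion 0 = 0"
        using laurent_expansion_Fract[of 1 0] by (simp add: Zero_fract_def)
      ultimately show ?thesis
        using False by (simp add: poincare_coeff_def)
    qed
  qed
qed

end
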